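(* Let $E$, the non-degenerate index-$k$ saddle point $x^*$, the constants $\delta,M,\mu,L$, and the iterates $x^{(n)}$, $v_i^{(n)}$ ($n\ge0$) of the A-HiSD algorithm with $x^{(-1)}=x^{(0)}$ be as described in the context, and suppose that Assumptions (I) and (II) of the context hold. Let $\kappa=L/\mu$, let $\varepsilon\in\big(0,\frac{1}{\sqrt\kappa+1}\big)$, and let the step size $\beta$ and momentum parameter $\gamma$ be chosen as $$\sqrt\beta=\frac{2}{\sqrt L+\sqrt\mu},\qquad \sqrt\gamma=1-\frac{2}{\sqrt\kappa+1}+\varepsilon .$$ Set $$K=\frac{2\sqrt2\,(\sqrt\kappa+1)^{1/2}}{\sqrt3\,\varepsilon},\qquad C_1=\Big(\frac{2\sqrt{2k}\,L}{\mu}+\frac12\Big)M,$$ and let $\hat r>0$ satisfy $$\hat r<\min\Big\{\delta,\ \frac{\sqrt3\,\mu\,\varepsilon^2(\sqrt\kappa+1)^{3/2}}{16\sqrt2\,C_1}\Big\}.$$ If $\|x^{(0)}-x^*\|_2\le\frac{\hat r}{2\sqrt2\,K}$, then $x^{(n)}$ converges to $x^*$ with $$\|x^{(n)}-x^*\|_2\le 2\sqrt2\,K\,\|x^{(0)}-x^*\|_2\,\theta^n\quad\text{for all }n\ge0,\qquad \theta:=1-\frac{2}{\sqrt\kappa+1}+2\varepsilon .$$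
   Context: $E:\mathbb{R}^d\to\mathbb{R}$ is an at least twice differentiable function, $1\le k\le d$, and $x^*$ is a non-degenerate index-$k$ saddle point of $E$: $\nabla E(x^* )=0$, and $\nabla^2E(x^* )$ is invertible with exactly $k$ negative eigenvalues. $\|\cdot\|_2$ denotes the Euclidean norm of vectors and the operator norm of matrices. A-HiSD algorithm: given $x^{(0)}\in\mathbb{R}^d$ and orthonormal $v_1^{(0)},\dots,v_k^{(0)}\in\mathbb{R}^d$, set $x^{(-1)}=x^{(0)}$ and for $n=0,1,2,\dots$ $$x^{(n+1)}=x^{(n)}-\beta\Big(I-2\sum_{i=1}^kv_i^{(n)}{v_i^{(n)}}^\top\Big)\nabla E(x^{(n)})+\gamma\,(x^{(n)}-x^{(n-1)}),$$ after which orthonormal vectors $v_1^{(n+1)},\dots,v_k^{(n+1)}$ are computed by an eigenvector solver for the $k$ smallest eigenvalues of $\nabla^2E(x^{(n+1)})$. Assumption (I): the initial position satisfies $x^{(0)}\in U(x^*,\delta)=\{x:\|x-x^*\|_2<\delta\}$ for some $\delta>0$ such that (i) there is a constant $M>0$ with $\|\nabla^2E(x)-\nabla^2E(y)\|_2\le M\|x-y\|_2$ for all $x,y\in U(x^*,\delta)$; (ii) there are constants $0<\mu<L$ such that for every $x\in U(x^*,\delta)$ the eigenvalues of $\nabla^2E(x)$ satisfy $\lambda_1\le\cdots\le\lambda_k<0<\lambda_{k+1}\le\cdots\le\lambda_d$ and $|\lambda_i|\in[\mu,L]$ for $1\le i\le d$. Assumption (II): for every $n\ge0$, $v_1^{(n)},\dots,v_k^{(n)}$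 are exact orthonormal eigenvectors corresponding to the $k$ smallest eigenvalues of $\nabla^2E(x^{(n)})$ (the error of the eigenvector solver is neglected). *)

theory Defs
  imports "HOL-Analysis.Analysis" "HOL-Computational_Algebra.Polynomial"
begin

definition grad :: "(real ^ 'n \<Rightarrow> real) \<Rightarrow> real ^ 'n \<Rightarrow> real ^ 'n::finite" where
  "grad E x = (\<chi> i. frechet_derivative E (at x) (axis i 1))"

definition hessian :: "(real ^ 'n \<Rightarrow> real) \<Rightarrow> real ^ 'n \<Rightarrow> real ^ 'n ^ 'n::finite" where
  "hessian E x = jacobian (grad E) (at x)"

definition twice_differentiable :: "(real ^ 'n::finite \<Rightarrow> real) \<Rightarrow> bool" where
  "twice_differentiable E \<longleftrightarrow>
     (\<forall>x. E differentiable (at x)) \<and> (\<forall>x. grad E differentiable (at x))"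

text \<open>
  The norm of the type \<open>real ^ 'n ^ 'n\<close> is the Frobenius norm, not the operator norm
  induced by the Euclidean norm.
\<close>

definition op_norm :: "real ^ 'n ^ 'n::finite \<Rightarrow> real" where
  "op_norm A = onorm ((*v) A)"

definition charpoly :: "real ^ 'n ^ 'n::finite \<Rightarrow> real poly" where
  "charpoly A = det (\<chi> i j. (if i = j then [:0, 1:] else 0) - [:A $ i $ j:])"

text \<open>
  The real eigenvalues, counted with algebraic multiplicity. For a symmetric matrix, in
  particular for the Hessian of a twice differentiable function, these are
  \<open>CARD('n)\<close> many.
\<close>

definition eigenvalues :: "real ^ 'n ^ 'n::finite \<Rightarrow> real multiset" where
  "eigenvalues A = proots (charpoly A)"

text \<open>The \<open>i\<close>-th smallest eigenvalue, where \<open>i\<close> ranges over \<open>{1..CARD('n)}\<close>.\<close>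

definition eigval :: "real ^ 'n ^ 'n::finite \<Rightarrow> nat \<Rightarrow> real" where
  "eigval A i = sorted_list_of_multiset (eigenvalues A) ! (i - 1)"

definition nondegenerate_saddle :: "(real ^ 'n::finite \<Rightarrow> real) \<Rightarrow> nat \<Rightarrow> real ^ 'n \<Rightarrow> bool" where
  "nondegenerate_saddle E k xs \<longleftrightarrow>
     grad E xs = 0 \<and> invertible (hessian E xs) \<and>
     size (filter_mset (\<lambda>l. l < 0) (eigenvalues (hessian E xs))) = k"

definition orthonormal_family :: "nat \<Rightarrow> (nat \<Rightarrow> real ^ 'n::finite) \<Rightarrow> bool" where
  "orthonormal_family k v \<longleftrightarrow>
     (\<forall>i\<in>{1..k}. \<forall>j\<in>{1..k}. v i \<bullet> v j = (if i = j then 1 else 0))"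

definition reflection :: "nat \<Rightarrow> (nat \<Rightarrow> real ^ 'n) \<Rightarrow> real ^ 'n ^ 'n::finite" where
  "reflection k v = mat 1 - 2 *\<^sub>R (\<Sum>i=1..k. (columnvector (v i) :: real ^ 1 ^ 'n) ** rowvector (v i))"

text \<open>
  The conditional encodes the convention that the iterate with index \<open>-1\<close> is \<open>x 0\<close>.
  The eigenvector solver is left unspecified apart from orthonormality of its output.
\<close>

definition ahisd ::
  "(real ^ 'n::finite \<Rightarrow> real) \<Rightarrow> nat \<Rightarrow> real \<Rightarrow> real \<Rightarrow> (nat \<Rightarrow> real ^ 'n) \<Rightarrow> (nat \<Rightarrow> nat \<Rightarrow> real ^ 'n) \<Rightarrow> bool"
  where
  "ahisd E k \<beta> \<gamma> x v \<longleftrightarrow>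
     (\<forall>n. orthonormal_family k (v n)) \<and>
     (\<forall>n. x (Suc n) = x n - \<beta> *\<^sub>R (reflection k (v n) *v grad E (x n))
                      + \<gamma> *\<^sub>R (x n - (if n = 0 then x 0 else x (n - 1))))"

definition assumption_I ::
  "(real ^ 'n::finite \<Rightarrow> real) \<Rightarrow> nat \<Rightarrow> real ^ 'n \<Rightarrow> real ^ 'n \<Rightarrow> real \<Rightarrow> real \<Rightarrow> real \<Rightarrow> real \<Rightarrow> bool"
  where
  "assumption_I E k xs x0 \<delta> M \<mu> L \<longleftrightarrow>
     \<delta> > 0 \<and> x0 \<in> ball xs \<delta> \<and>
     M > 0 \<and>
     (\<forall>x\<in>ball xs \<delta>. \<forall>y\<in>ball xs \<delta>. op_norm (hessian E x - hessian E y) \<le> M * norm (x - y)) \<and>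
     0 < \<mu> \<and> \<mu> < L \<and>
     (\<forall>x\<in>ball xs \<delta>.
        (\<forall>i\<in>{1..k}. eigval (hessian E x) i < 0) \<and>
        (\<forall>i\<in>{k+1..CARD('n)}. 0 < eigval (hessian E x) i) \<and>
        (\<forall>i\<in>{1..CARD('n)}. \<bar>eigval (hessian E x) i\<bar> \<in> {\<mu>..L}))"

text \<open>The eigenvectors of the \<open>k\<close> smallest eigenvalues may be listed in any order \<open>p\<close>.\<close>

definition assumption_II ::
  "(real ^ 'n::finite \<Rightarrow> real) \<Rightarrow> nat \<Rightarrow> (nat \<Rightarrow> real ^ 'n) \<Rightarrow> (nat \<Rightarrow> nat \<Rightarrow> real ^ 'n) \<Rightarrow> bool"
  where
  "assumption_II E k x v \<longleftrightarrow>
     (\<forall>n. orthonormal_family k (v n) \<and>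
        (\<exists>p. bij_betw p {1..k} {1..k} \<and>
          (\<forall>i\<in>{1..k}. hessian E (x n) *v v n i = eigval (hessian E (x n)) (p i) *\<^sub>R v n i)))"

end

theory Submission
  imports Defs
begin

text \<open>
  Write \<open>e\<^sub>n = x\<^sub>n - x\<^sup>*\<close>, \<open>H\<^sub>n\<close> and \<open>H\<^sub>*\<close> for the Hessians at \<open>x\<^sub>n\<close> and \<open>x\<^sup>*\<close>. The reflection
  \<open>I - 2 \<Sum> v\<^sub>i v\<^sub>i\<^sup>T\<close> flips exactly the eigenvectors of \<open>H\<^sub>n\<close> with negative eigenvalue and fixes the
  others, so it is the matrix sign \<open>sgn H\<^sub>n\<close> (\<open>reflection_eq_sign\<close>). Now \<open>\<nabla>E(x\<^sub>n)\<close> is \<open>H\<^sub>* e\<^sub>n\<close> up to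
  a quadratic error, and \<open>sgn\<close> is Lipschitz with constant \<open>1/\<mu>\<close> on symmetric matrices without
  eigenvalues in \<open>(-\<mu>, \<mu>)\<close> (\<open>sign_perturbation\<close>). Hence the reflected gradient is
  \<open>sgn H\<^sub>* H\<^sub>* e\<^sub>n = |H\<^sub>*| e\<^sub>n\<close> up to an error \<open>(1 + L/\<mu>) M \<parallel>e\<^sub>n\<parallel>\<^sup>2 \<le> C1 \<parallel>e\<^sub>n\<parallel>\<^sup>2\<close>
  (\<open>reflected_gradient_linearization\<close>): near the saddle the algorithm is the heavy ball method for
  the positive definite matrix \<open>|H\<^sub>*|\<close>, whose spectrum lies in \<open>[\<mu>, L]\<close>, with a quadratic perturbation.

  In an eigenbasis of \<open>|H\<^sub>*|\<close> the unperturbed iteration splits into scalar recurrences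
  \<open>y\<^sub>n\<^sub>+\<^sub>2 = p y\<^sub>n\<^sub>+\<^sub>1 - \<gamma> y\<^sub>n\<close> with \<open>p = 1 + \<gamma> - \<beta>\<lambda>\<close>. For the chosen \<open>\<beta>\<close> and \<open>\<gamma>\<close> the characteristic roots are
  complex for every \<open>\<lambda> \<in> [\<mu>, L]\<close>, with modulus \<open>\<rho> = \<surd>\<gamma>\<close>, and the squares of their imaginary parts are at least
  \<open>3\<epsilon>\<^sup>2 / (2(\<surd>\<kappa> + 1))\<close>. The impulse response is therefore at most \<open>(K/2) \<rho>\<^sup>n\<close>, uniformly in \<open>\<lambda>\<close>
  (\<open>momentum_kernel_bound_tuned\<close>). Variation of constants (\<open>perturbed_heavy_ball_duhamel\<close>) gives,
  as long as the iterates stay in the ball of radius \<open>\<delta>\<close>,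
  \<open>\<parallel>e\<^sub>n\<parallel> \<le> K \<rho>\<^sup>n \<parallel>e\<^sub>0\<parallel> + (K/2) \<beta> C1 \<Sum>\<^sub>j\<^sub><\<^sub>n \<rho>\<^sup>n\<^sup>-\<^sup>j \<parallel>e\<^sub>j\<parallel>\<^sup>2\<close>.

  An induction closes the estimate (\<open>perturbed_heavy_ball_convergence\<close>). If \<open>\<parallel>e\<^sub>j\<parallel> \<le> R \<theta>\<^sup>j\<close> for \<open>j < n\<close>
  with \<open>R = 2\<surd>2 K \<parallel>e\<^sub>0\<parallel> \<le> r\<close>, then, since \<open>\<theta> - \<rho> = \<epsilon>\<close>, the sum is at most a geometric sum of
  size \<open>R\<^sup>2 \<theta>\<^sup>n \<rho>/\<epsilon>\<close>. The bound on \<open>r\<close> is such that the perturbation contributes at most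
  \<open>R \<theta>\<^sup>n / 4\<close>, while the first term is \<open>R \<rho>\<^sup>n / (2\<surd>2)\<close>.
\<close>

section \<open>The spectral theorem for self-adjoint maps\<close>

definition selfadjoint :: "('a::euclidean_space \<Rightarrow> 'a) \<Rightarrow> bool" where
  "selfadjoint f \<longleftrightarrow> linear f \<and> (\<forall>x y. f x \<bullet> y = x \<bullet> f y)"

definition orthonormal :: "'a::euclidean_space set \<Rightarrow> bool" where
  "orthonormal B \<longleftrightarrow> pairwise orthogonal B \<and> (\<forall>b\<in>B. norm b = 1)"

text \<open>
  The Rayleigh quotient without its denominator, as it is taken at unit vectors only. At a unit
  eigenvector it is the eigenvalue.
\<close>

definition rayleigh :: "('a::euclidean_space \<Rightarrow> 'a) \<Rightarrow> 'a \<Rightarrow> real" where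
  "rayleigh f b = b \<bullet> f b"

definition eigenbasis :: "('a::euclidean_space \<Rightarrow> 'a) \<Rightarrow> 'a set \<Rightarrow> bool" where
  "eigenbasis f B \<longleftrightarrow> orthonormal B \<and> span B = UNIV \<and> (\<forall>b\<in>B. f b = rayleigh f b *\<^sub>R b)"

text \<open>
  A maximiser \<open>u\<close> of the quadratic form \<open>u \<bullet> f u\<close> on the unit sphere of the invariant subspace is an
  eigenvector: with \<open>m\<close> the maximum, the form of \<open>m - f\<close> is nonnegative on the subspace and vanishes at
  \<open>u\<close>, so its derivative at \<open>u\<close> in the direction of the defect \<open>z = m u - f u\<close> must vanish.
\<close>

lemma selfadjoint_eigenvector_in_subspace:
  fixes f :: "'a::euclidean_space \<Rightarrow> 'a"
  assumes f: "selfadjoint f" and S: "subspace S" "f ` S \<subseteq> S" and y: "y \<in> S" "y \<noteq> 0"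
  obtains u where "u \<in> S" "norm u = 1" "f u = rayleigh f u *\<^sub>R u"
proof -
  have lin: "linear f" and sa: "\<And>x y. f x \<bullet> y = x \<bullet> f y"
    using f by (auto simp: selfadjoint_def)
  let ?K = "S \<inter> sphere 0 1"
  have "compact ?K"
    using closed_subspace[OF S(1)] by (simp add: closed_Int_compact)
  moreover have "(1 / norm y) *\<^sub>R y \<in> ?K"
    using y S(1) by (simp add: subspace_scale)
  then have "?K \<noteq> {}" by blast
  moreover have "continuous_on ?K (\<lambda>u. u \<bullet> f u)"
    using lin by (intro continuous_intros linear_continuous_on) (simp add: linear_conv_bounded_linear)
  ultimately obtain u where u: "u \<in> ?K" and max: "\<And>w. w \<in> ?K \<Longrightarrow> w \<bullet> f w \<le> u \<bullet> f u"
    using continuous_attains_sup by meson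
  define m where "m = u \<bullet> f u"
  have bound: "w \<bullet> f w \<le> m * (w \<bullet> w)" if "w \<in> S" for w
  proof (cases "w = 0")
    case True
    then show ?thesis using lin by (simp add: linear_0)
  next
    case False
    then have "(1 / norm w) *\<^sub>R w \<in> ?K"
      using that S(1) by (simp add: subspace_scale)
    from max[OF this] have "(w \<bullet> f w) / (norm w)^2 \<le> m"
      by (simp add: m_def linear_scale[OF lin] power2_eq_square)
    then show ?thesis using False by (simp add: divide_le_eq power2_norm_eq_inner)
  qed
  define z where "z = m *\<^sub>R u - f u"
  have zS: "z \<in> S" unfolding z_def
    using u S by (intro subspace_diff subspace_scale) auto
  have uu: "u \<bullet> u = 1" using u by (simp add: norm_eq_1)
  define q where "q = m * (z \<bullet> z) - z \<bullet> f z"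
  have q0: "q \<ge> 0" using bound[OF zS] by (simp add: q_def)
  \<comment> \<open>the form of \<open>m - f\<close> is nonnegative at \<open>u - t z\<close>\<close>
  have key: "2 * t * (z \<bullet> z) \<le> t^2 * q" for t
  proof -
    have "u - t *\<^sub>R z \<in> S" using u zS S(1) by (intro subspace_diff subspace_scale) auto
    then have 1: "(u - t *\<^sub>R z) \<bullet> f (u - t *\<^sub>R z) \<le> m * ((u - t *\<^sub>R z) \<bullet> (u - t *\<^sub>R z))"
      by (rule bound)
    have 2: "(u - t *\<^sub>R z) \<bullet> f (u - t *\<^sub>R z) = m - 2 * t * (z \<bullet> f u) + t^2 * (z \<bullet> f z)"
      using sa[of u z] by (simp add: linear_diff[OF lin] linear_scale[OF lin] inner_diff m_def
          power2_eq_square inner_commute algebra_simps)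
    have 3: "(u - t *\<^sub>R z) \<bullet> (u - t *\<^sub>R z) = 1 - 2 * t * (z \<bullet> u) + t^2 * (z \<bullet> z)"
      using uu by (simp add: inner_diff power2_eq_square inner_commute algebra_simps)
    have 4: "z \<bullet> z = m * (z \<bullet> u) - z \<bullet> f u"
      by (subst (2) z_def) (simp add: inner_diff)
    have "2 * t * (z \<bullet> z) = 2 * t * (m * (z \<bullet> u) - z \<bullet> f u)" by (subst 4) simp
    then show ?thesis using 1 unfolding 2 3 q_def by (simp add: algebra_simps)
  qed
  have "z \<bullet> z = 0"
  proof (rule ccontr)
    assume "z \<bullet> z \<noteq> 0"
    then have pos: "z \<bullet> z > 0" by simp
    define t where "t = (z \<bullet> z) / (q + 1)"
    have "t > 0" using pos q0 by (simp add: t_def)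
    with key[of t] have "2 * (z \<bullet> z) \<le> t * q" by (simp add: power2_eq_square)
    also have "\<dots> \<le> z \<bullet> z" using pos q0 by (simp add: t_def field_simps)
    finally show False using pos by simp
  qed
  then have "f u = rayleigh f u *\<^sub>R u" by (simp add: z_def m_def rayleigh_def)
  with u that show ?thesis by auto
qed

lemma orthonormal_independent: "orthonormal B \<Longrightarrow> independent B"
  unfolding orthonormal_def by (rule pairwise_orthogonal_independent) auto

lemma orthonormal_finite: "orthonormal B \<Longrightarrow> finite B"
  by (simp add: independent_imp_finite orthonormal_independent)

text \<open>
  The spectral theorem, in the form in which some eigenvectors are already prescribed: the
  orthogonal complement of a set of eigenvectors is invariant, so it contains another one. Prescribed
  vectors occur because the output of the eigenvector solver has to be part of the basis.
\<close>

lemma selfadjoint_extend_eigenbasis: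
  fixes f :: "'a::euclidean_space \<Rightarrow> 'a"
  assumes f: "selfadjoint f" and A: "orthonormal A" "\<And>a. a \<in> A \<Longrightarrow> f a = rayleigh f a *\<^sub>R a"
  obtains B where "A \<subseteq> B" "eigenbasis f B"
  using A
proof (induction "DIM('a) - card A" arbitrary: A thesis rule: less_induct)
  case less
  show ?case
  proof (cases "span A = UNIV")
    case True
    with less.prems show ?thesis by (auto simp: eigenbasis_def)
  next
    case False
    have dimA: "dim A = card A"
      using less.prems(2) by (simp add: dim_eq_card_independent orthonormal_independent)
    have "dim A < DIM('a)"
      using False dim_eq_full[of A] dim_subset_UNIV[of A] by linarith
    then obtain y where y: "y \<noteq> 0" "\<And>a. a \<in> span A \<Longrightarrow> orthogonal y a"
      by (rule orthogonal_to_subspace_exists) blast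
    let ?S = "{y. \<forall>a\<in>A. orthogonal a y}"
    have S: "f ` ?S \<subseteq> ?S"
    proof clarsimp
      fix w a assume w: "\<forall>a\<in>A. orthogonal a w" and a: "a \<in> A"
      have "a \<bullet> f w = f a \<bullet> w" using f by (simp add: selfadjoint_def)
      also have "\<dots> = rayleigh f a * (a \<bullet> w)"
        by (subst less.prems(3)[OF a]) simp
      finally show "orthogonal a (f w)" using w a by (simp add: orthogonal_def)
    qed
    have yS: "y \<in> ?S" using y(2) by (auto simp: orthogonal_commute span_base)
    obtain u where u: "u \<in> ?S" "norm u = 1" "f u = rayleigh f u *\<^sub>R u"
      by (rule selfadjoint_eigenvector_in_subspace[OF f subspace_orthogonal_to_vectors S yS y(1)])
    have "u \<notin> A" using u by (auto simp: orthogonal_def norm_eq_1)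
    have on: "orthonormal (insert u A)"
      using less.prems(2) u by (auto simp: orthonormal_def pairwise_insert orthogonal_commute)
    have "card (insert u A) = Suc (card A)"
      using \<open>u \<notin> A\<close> orthonormal_finite[OF less.prems(2)] by simp
    then have lt: "DIM('a) - card (insert u A) < DIM('a) - card A"
      using dimA \<open>dim A < DIM('a)\<close> by simp
    show ?thesis
      by (rule less.hyps[OF lt _ on]) (use less.prems u in auto)
  qed
qed

text \<open>
  When \<open>B\<close> is an eigenbasis of \<open>f\<close> and \<open>g b = \<phi> (rayleigh f b)\<close>, this is the functional calculus \<open>\<phi> f\<close>.
  The functions \<open>sgn f\<close> and \<open>|f|\<close> are obtained in this way.
\<close>

definition spectral_map :: "'a::euclidean_space set \<Rightarrow> ('a \<Rightarrow> real) \<Rightarrow> 'a \<Rightarrow> 'a" where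
  "spectral_map B g w = (\<Sum>b\<in>B. (g b * (b \<bullet> w)) *\<^sub>R b)"

context
  fixes B :: "'a::euclidean_space set"
  assumes on: "orthonormal B" and sp: "span B = UNIV"
begin

lemma orthonormal_inner: "b \<in> B \<Longrightarrow> c \<in> B \<Longrightarrow> b \<bullet> c = (if b = c then 1 else 0)"
  using on by (auto simp: orthonormal_def pairwise_def orthogonal_def norm_eq_1)

lemma orthonormal_ext:
  assumes "\<And>b. b \<in> B \<Longrightarrow> b \<bullet> w = b \<bullet> y" shows "w = y"
proof -
  have "(w - y) \<bullet> z = 0" for z
  proof -
    have "orthogonal (w - y) z"
      by (rule orthogonal_to_span[of _ B]) (use assms sp in \<open>auto simp: orthogonal_def inner_diff inner_commute\<close>)
    then show ?thesis by (simp add: orthogonal_def)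
  qed
  from this[of "w - y"] show ?thesis by simp
qed

lemma inner_spectral_map:
  assumes "b \<in> B" shows "b \<bullet> spectral_map B g w = g b * (b \<bullet> w)"
proof -
  have "b \<bullet> spectral_map B g w = (\<Sum>c\<in>B. if c = b then g b * (b \<bullet> w) else 0)"
    unfolding spectral_map_def inner_sum_right
    by (intro sum.cong) (auto simp: orthonormal_inner assms)
  then show ?thesis using assms orthonormal_finite[OF on] by simp
qed

lemma parseval: "w \<bullet> y = (\<Sum>b\<in>B. (b \<bullet> w) * (b \<bullet> y))"
proof -
  have "spectral_map B (\<lambda>_. 1) w = w"
    by (rule orthonormal_ext) (simp add: inner_spectral_map)
  then have "w \<bullet> y = spectral_map B (\<lambda>_. 1) w \<bullet> y" by simp
  then show ?thesis by (simp add: spectral_map_def inner_sum_left)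
qed

lemma linear_spectral_map: "linear (spectral_map B g)"
  by (rule linearI; rule orthonormal_ext) (simp_all add: inner_spectral_map inner_add_right algebra_simps)

lemma selfadjoint_spectral_map: "selfadjoint (spectral_map B g)"
proof -
  have "spectral_map B g w \<bullet> y = w \<bullet> spectral_map B g y" for w y
    unfolding parseval[of "spectral_map B g w"] parseval[of w "spectral_map B g y"]
    by (intro sum.cong) (simp_all add: inner_spectral_map)
  then show ?thesis by (simp add: selfadjoint_def linear_spectral_map)
qed

lemma spectral_map_compose:
  "spectral_map B g (spectral_map B h w) = spectral_map B (\<lambda>b. g b * h b) w"
  by (rule orthonormal_ext) (simp add: inner_spectral_map)

lemma norm_spectral_map_le:
  assumes "\<And>b. b \<in> B \<Longrightarrow> \<bar>g b\<bar> \<le> C" and "0 \<le> C"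
  shows "norm (spectral_map B g w) \<le> C * norm w"
proof (rule power2_le_imp_le)
  have "(norm (spectral_map B g w))\<^sup>2 = (\<Sum>b\<in>B. (g b)^2 * (b \<bullet> w)^2)"
    unfolding power2_norm_eq_inner parseval[of "spectral_map B g w"]
    by (intro sum.cong) (simp_all add: inner_spectral_map power2_eq_square algebra_simps)
  also have "\<dots> \<le> (\<Sum>b\<in>B. C^2 * (b \<bullet> w)^2)"
    using assms by (intro sum_mono mult_right_mono) (auto simp: abs_le_square_iff[symmetric])
  also have "\<dots> = C^2 * (w \<bullet> w)"
    unfolding parseval[of w w] sum_distrib_left by (simp add: power2_eq_square)
  also have "\<dots> = (C * norm w)\<^sup>2" by (simp add: power_mult_distrib power2_norm_eq_inner)
  finally show "(norm (spectral_map B g w))\<^sup>2 \<le> (C * norm w)\<^sup>2" .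
qed (use assms in simp)

lemma inner_spectral_map_ge:
  assumes "\<And>b. b \<in> B \<Longrightarrow> m \<le> g b"
  shows "m * (w \<bullet> w) \<le> w \<bullet> spectral_map B g w"
proof -
  have "m * (w \<bullet> w) = (\<Sum>b\<in>B. m * (b \<bullet> w)^2)"
    unfolding parseval[of w w] sum_distrib_left by (simp add: power2_eq_square)
  also have "\<dots> \<le> (\<Sum>b\<in>B. g b * (b \<bullet> w)^2)"
    using assms by (intro sum_mono mult_right_mono) auto
  also have "\<dots> = w \<bullet> spectral_map B g w"
    unfolding parseval[of w "spectral_map B g w"]
    by (intro sum.cong) (simp_all add: inner_spectral_map power2_eq_square algebra_simps)
  finally show ?thesis .
qed

end

lemma eigenbasisD:
  assumes "eigenbasis f B"
  shows "orthonormal B" "span B = UNIV" "\<And>b. b \<in> B \<Longrightarrow> f b = rayleigh f b *\<^sub>R b"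
  using assms by (auto simp: eigenbasis_def)

lemma eigenbasis_spectral_map:
  assumes f: "selfadjoint f" and B: "eigenbasis f B"
  shows "f w = spectral_map B (rayleigh f) w"
proof (rule orthonormal_ext[OF eigenbasisD(1,2)[OF B]])
  fix b assume b: "b \<in> B"
  have "b \<bullet> f w = f b \<bullet> w" using f by (simp add: selfadjoint_def)
  also have "\<dots> = rayleigh f b * (b \<bullet> w)" by (subst eigenbasisD(3)[OF B b]) simp
  finally show "b \<bullet> f w = b \<bullet> spectral_map B (rayleigh f) w"
    by (simp add: inner_spectral_map[OF eigenbasisD(1,2)[OF B] b])
qed

section \<open>Sensitivity of the matrix sign function\<close>

text \<open>
  With \<open>S = sgn f\<close>, \<open>T = sgn g\<close> and \<open>X = S - T\<close>, the identities \<open>|f| S = f\<close>, \<open>|f| = S f\<close>, \<open>T |g| = g\<close> and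
  \<open>|g| = g T\<close> turn the difference of the signs into the solution of a Sylvester equation,
  \<open>|f| X + X |g| = (f - g) - S (f - g) T\<close>. Its right-hand side has norm at most \<open>2 d\<close>. As \<open>X\<close> is
  self-adjoint, pairing the equation with a unit eigenvector \<open>u\<close> of \<open>X\<close>, with eigenvalue \<open>\<tau>\<close>, gives
  \<open>\<tau> (u \<bullet> |f| u + u \<bullet> |g| u)\<close> on the left, which is at least \<open>2 \<mu> |\<tau>|\<close> in absolute value. So
  \<open>|\<tau>| \<le> d/\<mu>\<close> for every eigenvalue of \<open>X\<close>.
\<close>

lemma sign_perturbation:
  fixes f g :: "'a::euclidean_space \<Rightarrow> 'a"
  assumes f: "selfadjoint f" "eigenbasis f B" and g: "selfadjoint g" "eigenbasis g C"
    and fmu: "\<And>b. b \<in> B \<Longrightarrow> \<mu> \<le> \<bar>rayleigh f b\<bar>" and gmu: "\<And>c. c \<in> C \<Longrightarrow> \<mu> \<le> \<bar>rayleigh g c\<bar>"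
    and mu: "0 < \<mu>"
    and d: "\<And>w. norm (f w - g w) \<le> d * norm w"
  shows "norm (spectral_map B (\<lambda>b. sgn (rayleigh f b)) w - spectral_map C (\<lambda>c. sgn (rayleigh g c)) w)
         \<le> d / \<mu> * norm w"
proof -
  note B = eigenbasisD(1,2)[OF f(2)] and C = eigenbasisD(1,2)[OF g(2)]
  define S where "S = spectral_map B (\<lambda>b. sgn (rayleigh f b))"
  define T where "T = spectral_map C (\<lambda>c. sgn (rayleigh g c))"
  define F where "F = spectral_map B (\<lambda>b. \<bar>rayleigh f b\<bar>)"
  define G where "G = spectral_map C (\<lambda>c. \<bar>rayleigh g c\<bar>)"
  define X where "X w = S w - T w" for w
  have saS: "selfadjoint S" and saT: "selfadjoint T" and saF: "selfadjoint F" and saG: "selfadjoint G"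
    unfolding S_def T_def F_def G_def using B C by (auto intro: selfadjoint_spectral_map)
  have X: "selfadjoint X"
    using saS saT unfolding X_def selfadjoint_def
    by (auto simp: inner_diff intro: linear_compose_sub)
  have nS: "norm (S w) \<le> norm w" and nT: "norm (T w) \<le> norm w" for w
    unfolding S_def T_def
    using norm_spectral_map_le[OF B, of "\<lambda>b. sgn (rayleigh f b)" 1 w]
      norm_spectral_map_le[OF C, of "\<lambda>b. sgn (rayleigh g b)" 1 w] by (auto simp: sgn_if)
  have fB: "f w = spectral_map B (rayleigh f) w" for w using eigenbasis_spectral_map[OF f] .
  have gC: "g w = spectral_map C (rayleigh g) w" for w using eigenbasis_spectral_map[OF g] .
  have FS: "F (S w) = f w" for w
    using spectral_map_compose[OF B, of "\<lambda>b. \<bar>rayleigh f b\<bar>" "\<lambda>b. sgn (rayleigh f b)" w]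
    by (simp add: F_def S_def fB[of w] abs_mult_sgn)
  have FT: "F w = S (f w)" for w
    using spectral_map_compose[OF B, of "\<lambda>b. sgn (rayleigh f b)" "rayleigh f" w]
    by (simp add: F_def S_def fB[of w] abs_sgn mult.commute)
  have TG: "T (G w) = g w" for w
    using spectral_map_compose[OF C, of "\<lambda>b. sgn (rayleigh g b)" "\<lambda>b. \<bar>rayleigh g b\<bar>" w]
    by (simp add: G_def T_def gC[of w] sgn_mult_abs)
  have GT: "G w = g (T w)" for w
    using spectral_map_compose[OF C, of "rayleigh g" "\<lambda>b. sgn (rayleigh g b)" w]
    by (simp add: G_def T_def gC[of "T w", unfolded T_def] abs_sgn)
  have id: "F (X w) + X (G w) = (f w - g w) - S (f (T w) - g (T w))" for w
  proof -
    have "F (S w - T w) = F (S w) - F (T w)" "S (f (T w) - g (T w)) = S (f (T w)) - S (g (T w))"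
      using saF saS by (auto simp: selfadjoint_def linear_diff)
    then show ?thesis
      unfolding X_def using FS[of w] FT[of "T w"] TG[of w] GT[of w] by simp
  qed
  have d0: "0 \<le> d"
  proof -
    obtain b :: 'a where "b \<in> Basis" using nonempty_Basis by blast
    then have "norm b = 1" by simp
    with d[of b] show ?thesis by (metis mult_1_right norm_ge_zero order_trans)
  qed
  obtain D where D: "eigenbasis X D"
    using selfadjoint_extend_eigenbasis[OF X, of "{}"] by (auto simp: orthonormal_def)
  note D' = eigenbasisD(1,2)[OF D]
  have eig: "\<bar>rayleigh X u\<bar> \<le> d / \<mu>" if u: "u \<in> D" for u
  proof -
    define \<tau> where "\<tau> = rayleigh X u"
    have Xu: "X u = \<tau> *\<^sub>R u" using eigenbasisD(3)[OF D u] by (simp add: \<tau>_def)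
    have un: "norm u = 1" using D'(1) u by (auto simp: orthonormal_def)
    have uu: "u \<bullet> u = 1" using un by (simp add: norm_eq_1)
    have F: "\<mu> \<le> u \<bullet> F u" using inner_spectral_map_ge[OF B, of \<mu> "\<lambda>b. \<bar>rayleigh f b\<bar>" u] fmu uu by (auto simp: F_def)
    have G: "\<mu> \<le> u \<bullet> G u" using inner_spectral_map_ge[OF C, of \<mu> "\<lambda>b. \<bar>rayleigh g b\<bar>" u] gmu uu by (auto simp: G_def)
    have "u \<bullet> (F (X u) + X (G u)) = \<tau> * (u \<bullet> F u + u \<bullet> G u)"
    proof -
      have "F (X u) = \<tau> *\<^sub>R F u" unfolding Xu using saF by (simp add: selfadjoint_def linear_scale)
      moreover have "u \<bullet> X (G u) = X u \<bullet> G u" using X by (simp add: selfadjoint_def)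
      ultimately show ?thesis unfolding Xu by (simp add: inner_add_right algebra_simps)
    qed
    then have "\<bar>\<tau>\<bar> * (u \<bullet> F u + u \<bullet> G u) = \<bar>u \<bullet> (F (X u) + X (G u))\<bar>"
      using F G mu by (simp add: abs_mult)
    also have "\<dots> \<le> norm (F (X u) + X (G u))"
      using Cauchy_Schwarz_ineq2[of u "F (X u) + X (G u)"] un by simp
    also have "\<dots> \<le> norm (f u - g u) + norm (S (f (T u) - g (T u)))"
      unfolding id by (rule norm_triangle_ineq4)
    also have "\<dots> \<le> norm (f u - g u) + d * norm (T u)"
      using order_trans[OF nS d] by (intro add_left_mono) auto
    also have "\<dots> \<le> d + d"
      using d[of u] mult_left_mono[OF nT[of u] d0] un by simp
    finally have "\<bar>\<tau>\<bar> * (u \<bullet> F u + u \<bullet> G u) \<le> 2 * d" by simp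
    moreover have "\<bar>\<tau>\<bar> * (2 * \<mu>) \<le> \<bar>\<tau>\<bar> * (u \<bullet> F u + u \<bullet> G u)"
      using F G by (intro mult_left_mono) auto
    ultimately have "\<bar>\<tau>\<bar> * \<mu> \<le> d" by simp
    then show ?thesis using mu by (simp add: \<tau>_def pos_le_divide_eq)
  qed
  have "norm (X w) \<le> d / \<mu> * norm w"
    by (subst eigenbasis_spectral_map[OF X D], rule norm_spectral_map_le[OF D' eig]) (use d0 mu in auto)
  then show ?thesis by (simp add: X_def S_def T_def)
qed

section \<open>Eigenvalue counts and the reflection\<close>

lemma poly_det: "poly (det A) x = det (\<chi> i j. poly (A $ i $ j) x)"
  for A :: "real poly ^ 'n::finite ^ 'n"
  by (simp add: det_def poly_sum poly_prod poly_mult of_int_poly)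

lemma card_eigenbasis: "eigenbasis f B \<Longrightarrow> card B = DIM('a)"
  for f :: "'a::euclidean_space \<Rightarrow> 'a"
  by (metis eigenbasis_def orthonormal_independent dim_eq_card_independent dim_span dim_UNIV)

text \<open>
  With the eigenvectors as the columns of \<open>Q\<close>, the matrix \<open>X = x I - H\<close> satisfies \<open>X Q = Q D\<close> for
  a diagonal \<open>D\<close>, and \<open>det Q\<close> cancels because \<open>Q\<^sup>T Q = I\<close>.
\<close>

lemma det_eigenbasis:
  fixes H :: "real ^ 'n::finite ^ 'n"
  assumes B: "eigenbasis ((*v) H) B"
  shows "det (\<chi> i j. (if i = j then x else 0) - H $ i $ j) = (\<Prod>b\<in>B. x - rayleigh ((*v) H) b)"
proof -
  note B' = eigenbasisD[OF B]
  have "card B = CARD('n)"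
    using card_eigenbasis[OF B] by simp
  then obtain q where q: "bij_betw q (UNIV :: 'n set) B"
    using orthonormal_finite[OF B'(1)] finite_same_card_bij[of "UNIV :: 'n set" B] by auto
  define Q :: "real ^ 'n ^ 'n" where "Q = (\<chi> i j. q j $ i)"
  define X where "X = (\<chi> i j. (if i = j then x else 0) - H $ i $ j)"
  define D :: "real ^ 'n ^ 'n" where "D = (\<chi> i j. if i = j then x - rayleigh ((*v) H) (q i) else 0)"
  have qB: "q j \<in> B" for j using q by (auto simp: bij_betw_def)
  have qq: "q i \<bullet> q j = (if i = j then 1 else 0)" for i j
    using orthonormal_inner[OF B'(1,2) qB qB, of i j] q by (auto simp: bij_betw_def inj_eq)
  have "transpose Q ** Q = mat 1"
    using qq by (simp add: vec_eq_iff matrix_matrix_mult_def transpose_def Q_def mat_def inner_vec_def)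
  then have "det (transpose Q) * det Q = 1" by (metis det_mul det_I)
  then have nz: "det Q \<noteq> 0" by auto
  have "X ** Q = Q ** D"
  proof -
    have "(X ** Q) $ i $ j = (Q ** D) $ i $ j" for i j
    proof -
      have "(X ** Q) $ i $ j = x * q j $ i - (H *v q j) $ i"
        by (simp add: matrix_matrix_mult_def X_def Q_def matrix_vector_mult_def left_diff_distrib
            sum_subtractf if_distrib[of "\<lambda>a. a * _"] cong: if_cong)
      also have "(H *v q j) $ i = rayleigh ((*v) H) (q j) * q j $ i"
        by (subst B'(3)[OF qB]) simp
      also have "x * q j $ i - \<dots> = (Q ** D) $ i $ j"
        by (simp add: matrix_matrix_mult_def D_def Q_def if_distrib[of "\<lambda>a. _ * a"] algebra_simps cong: if_cong)
      finally show ?thesis .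
    qed
    then show ?thesis by (simp add: vec_eq_iff)
  qed
  then have "det X * det Q = det Q * det D" by (metis det_mul)
  then have "det X = det D" using nz by simp
  also have "\<dots> = (\<Prod>i\<in>UNIV. x - rayleigh ((*v) H) (q i))"
    by (subst det_diagonal) (simp_all add: D_def)
  also have "\<dots> = (\<Prod>b\<in>B. x - rayleigh ((*v) H) b)"
    by (rule prod.reindex_bij_betw[OF q])
  finally show ?thesis by (simp add: X_def)
qed

lemma eigenvalues_eigenbasis:
  fixes H :: "real ^ 'n::finite ^ 'n"
  assumes B: "eigenbasis ((*v) H) B"
  shows "eigenvalues H = image_mset (rayleigh ((*v) H)) (mset_set B)"
proof -
  let ?e = "rayleigh ((*v) H)"
  have "charpoly H = (\<Prod>b\<in>B. [:- ?e b, 1:])"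
  proof -
    have "poly (charpoly H) x = poly (\<Prod>b\<in>B. [:- ?e b, 1:]) x" for x
    proof -
      have "poly (charpoly H) x = det (\<chi> i j. (if i = j then x else 0) - H $ i $ j)"
        unfolding charpoly_def poly_det by (rule arg_cong[where f=det]) (simp add: vec_eq_iff)
      then show ?thesis using det_eigenbasis[OF B] by (simp add: poly_prod)
    qed
    then show ?thesis by (simp add: poly_eq_poly_eq_iff[symmetric] fun_eq_iff)
  qed
  then have "eigenvalues H = (\<Sum>b\<in>B. {#?e b#})"
    by (simp add: eigenvalues_def proots_prod)
  also have "\<dots> = image_mset ?e (mset_set B)"
    using orthonormal_finite[OF eigenbasisD(1)[OF B]]
    by (induction B rule: finite_induct) auto
  finally show ?thesis .
qed

definition saddle_spectrum :: "real ^ 'n::finite ^ 'n \<Rightarrow> nat \<Rightarrow> real \<Rightarrow> real \<Rightarrow> bool" where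
  "saddle_spectrum H k \<mu> L \<longleftrightarrow>
     (\<forall>i\<in>{1..k}. eigval H i < 0) \<and>
     (\<forall>i\<in>{k+1..CARD('n)}. 0 < eigval H i) \<and>
     (\<forall>i\<in>{1..CARD('n)}. \<bar>eigval H i\<bar> \<in> {\<mu>..L})"

text \<open>
  The assumption on the spectrum speaks of the sorted roots of the characteristic polynomial. As
  these are the eigenvalues along any eigenbasis, with multiplicity, the same signs and bounds hold
  there.
\<close>

lemma eigenbasis_count:
  fixes H :: "real ^ 'n::finite ^ 'n"
  assumes B: "eigenbasis ((*v) H) B"
    and k: "k \<le> CARD('n)"
    and spec: "saddle_spectrum H k \<mu> L"
  shows "card {b \<in> B. rayleigh ((*v) H) b < 0} = k"
    and "\<And>b. b \<in> B \<Longrightarrow> \<bar>rayleigh ((*v) H) b\<bar> \<in> {\<mu>..L}"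
proof -
  let ?e = "rayleigh ((*v) H)"
  note B' = eigenbasisD[OF B]
  have fin: "finite B" by (rule orthonormal_finite[OF B'(1)])
  have cB: "card B = CARD('n)"
    using card_eigenbasis[OF B] by simp
  define l where "l = sorted_list_of_multiset (eigenvalues H)"
  have ml: "mset l = image_mset ?e (mset_set B)"
    by (simp add: l_def eigenvalues_eigenbasis[OF B])
  have len: "length l = CARD('n)"
    using arg_cong[OF ml, of size] cB by simp
  have ev: "l ! i = eigval H (Suc i)" for i by (simp add: eigval_def l_def)
  have sl: "set l = ?e ` B" using arg_cong[OF ml, of set_mset] fin by simp
  show "\<bar>?e b\<bar> \<in> {\<mu>..L}" if "b \<in> B" for b
  proof -
    have "?e b \<in> set l" using that sl by auto
    then obtain i where "i < length l" "l ! i = ?e b" by (auto simp: in_set_conv_nth)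
    moreover from this have "Suc i \<in> {1..CARD('n)}" using len by simp
    ultimately show ?thesis using spec ev[of i] unfolding saddle_spectrum_def by metis
  qed
  have "length (filter (\<lambda>a. a < 0) l) = card {i. i < length l \<and> l ! i < 0}"
    by (rule length_filter_conv_card)
  also have "{i. i < length l \<and> l ! i < 0} = {..<k}"
  proof -
    have "l ! i < 0 \<longleftrightarrow> i < k" if "i < length l" for i
    proof (cases "i < k")
      case True
      then show ?thesis using spec ev[of i] by (simp add: saddle_spectrum_def)
    next
      case False
      then have "Suc i \<in> {k+1..CARD('n)}" using that len by simp
      then have "0 < l ! i" using spec ev[of i] unfolding saddle_spectrum_def by metis
      then show ?thesis using False by simp
    qed
    then show ?thesis using len k by auto
  qed
  finally have "size (filter_mset (\<lambda>a. a < 0) (mset l)) = k"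
    by (simp flip: mset_filter)
  then show "card {b \<in> B. ?e b < 0} = k"
    using fin by (simp add: ml filter_mset_image_mset)
qed

lemma reflection_mult_vec:
  fixes v :: "nat \<Rightarrow> real ^ 'n::finite"
  shows
  "reflection k v *v w = w - 2 *\<^sub>R (\<Sum>i=1..k. (v i \<bullet> w) *\<^sub>R v i)"
proof -
  have s: "(\<Sum>i\<in>I. A i) *v w = (\<Sum>i\<in>I. A i *v w)" if "finite I" for A :: "nat \<Rightarrow> real^'n^'n" and I
    using that by (induction I rule: finite_induct) (auto simp: matrix_vector_mult_add_rdistrib)
  have "((columnvector (v i) :: real ^ 1 ^ 'n) ** rowvector (v i)) *v w = (v i \<bullet> w) *\<^sub>R v i" for i
    by (simp add: vec_eq_iff matrix_vector_mult_def matrix_matrix_mult_def columnvector_def rowvector_def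
        inner_vec_def sum_distrib_left mult_ac)
  moreover have "(2 *\<^sub>R A) *v w = 2 *\<^sub>R (A *v w)" for A :: "real^'n^'n"
    by (simp add: scaleR_matrix_vector_assoc)
  ultimately show ?thesis
    by (simp add: reflection_def matrix_vector_mult_diff_rdistrib s)
qed

text \<open>
  The \<open>v i\<close> are \<open>k\<close> eigenvectors with negative eigenvalues. In an eigenbasis that extends them there are
  exactly \<open>k\<close> such vectors, so the reflection flips precisely the negative part of the basis.
\<close>

lemma reflection_eq_sign:
  fixes H :: "real ^ 'n::finite ^ 'n"
  assumes H: "selfadjoint ((*v) H)" and mu: "0 < \<mu>"
    and k: "k \<le> CARD('n)"
    and spec: "saddle_spectrum H k \<mu> L"
    and on: "orthonormal_family k v"
    and p: "bij_betw p {1..k} {1..k}"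
    and eig: "\<And>i. i \<in> {1..k} \<Longrightarrow> H *v v i = eigval H (p i) *\<^sub>R v i"
  obtains B where "eigenbasis ((*v) H) B"
    "\<And>w. reflection k v *v w = spectral_map B (\<lambda>b. sgn (rayleigh ((*v) H) b)) w"
proof -
  let ?e = "rayleigh ((*v) H)"
  have vv: "v i \<bullet> v j = (if i = j then 1 else 0)" if "i \<in> {1..k}" "j \<in> {1..k}" for i j
    using on that by (auto simp: orthonormal_family_def)
  have ev: "?e (v i) = eigval H (p i)" if "i \<in> {1..k}" for i
    using eig[OF that] vv[OF that that] by (simp add: rayleigh_def)
  have inj: "inj_on v {1..k}"
  proof (rule inj_onI)
    fix i j assume "i \<in> {1..k}" "j \<in> {1..k}" "v i = v j"
    then show "i = j" using vv[of i j] vv[of i i] by (auto split: if_splits)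
  qed
  have "orthonormal (v ` {1..k})"
    using vv by (auto simp: orthonormal_def pairwise_def orthogonal_def norm_eq_1)
  moreover have "H *v a = ?e a *\<^sub>R a" if "a \<in> v ` {1..k}" for a
    using that eig ev by auto
  ultimately obtain B where B: "v ` {1..k} \<subseteq> B" "eigenbasis ((*v) H) B"
    using selfadjoint_extend_eigenbasis[OF H] by blast
  note B' = eigenbasisD[OF B(2)]
  note cnt = eigenbasis_count[OF B(2) k spec]
  have fin: "finite B" by (rule orthonormal_finite[OF B'(1)])
  have "v ` {1..k} = {b \<in> B. ?e b < 0}"
  proof (rule card_subset_eq)
    have "p i \<in> {1..k}" if "i \<in> {1..k}" for i using p that by (auto simp: bij_betw_def)
    then have "?e (v i) < 0" if "i \<in> {1..k}" for i using ev[OF that] spec that by (simp add: saddle_spectrum_def)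
    then show "v ` {1..k} \<subseteq> {b \<in> B. ?e b < 0}" using B(1) by auto
    show "card (v ` {1..k}) = card {b \<in> B. ?e b < 0}"
      using inj by (simp add: card_image cnt(1))
  qed (use fin in simp)
  have distinct_v: "b \<noteq> v i" if "b \<in> B" "\<not> ?e b < 0" "i \<in> {1..k}" for b i
    using \<open>v ` {1..k} = _\<close> that by auto
  have sg: "?e b > 0" if "b \<in> B" "\<not> ?e b < 0" for b
    using cnt(2)[OF that(1)] that(2) mu by auto
  have "reflection k v *v w = spectral_map B (\<lambda>b. sgn (?e b)) w" for w
  proof (rule orthonormal_ext[OF B'(1,2)])
    fix b assume b: "b \<in> B"
    have *: "b \<bullet> (reflection k v *v w) = b \<bullet> w - 2 * (\<Sum>i=1..k. (v i \<bullet> w) * (b \<bullet> v i))"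
      by (simp add: reflection_mult_vec inner_diff_right inner_sum_right)
    have "\<dots> = sgn (?e b) * (b \<bullet> w)"
    proof (cases "?e b < 0")
      case True
      then obtain j where j: "j \<in> {1..k}" "b = v j" using \<open>v ` {1..k} = _\<close> b by blast
      have "(\<Sum>i=1..k. (v i \<bullet> w) * (b \<bullet> v i)) = (\<Sum>i=1..k. if i = j then b \<bullet> w else 0)"
        by (intro sum.cong) (use j vv in auto)
      also have "\<dots> = b \<bullet> w" using j by simp
      finally show ?thesis using True by simp
    next
      case False
      have "(\<Sum>i=1..k. (v i \<bullet> w) * (b \<bullet> v i)) = 0"
      proof (intro sum.neutral ballI)
        fix i assume i: "i \<in> {1..k}"
        then have "v i \<in> B" using B(1) by auto
        then show "(v i \<bullet> w) * (b \<bullet> v i) = 0"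
          using orthonormal_inner[OF B'(1,2) b] distinct_v[OF b False i] by auto
      qed
      then show ?thesis using sg[OF b False] by simp
    qed
    with * show "b \<bullet> (reflection k v *v w) = b \<bullet> spectral_map B (\<lambda>b. sgn (?e b)) w"
      by (simp add: inner_spectral_map[OF B'(1,2) b])
  qed
  with B(2) that show ?thesis by blast
qed

section \<open>The Hessian and the reflected gradient\<close>

text \<open>
  Schwarz's theorem for a gradient that is differentiable at one point. By the mean value theorem
  along \<open>u\<close> and the differentiability of \<open>G\<close> at \<open>x\<close>, the second difference
  \<open>E(x + tu + tw) - E(x + tu) - E(x + tw) + E(x)\<close> is \<open>t\<^sup>2 (u \<bullet> H w) + o(t\<^sup>2)\<close>. It is symmetric in \<open>u\<close>
  and \<open>w\<close>, so it is also \<open>t\<^sup>2 (w \<bullet> H u) + o(t\<^sup>2)\<close>.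
\<close>

lemma symmetric_second_derivative:
  fixes E :: "'a::euclidean_space \<Rightarrow> real"
  assumes E: "\<And>y. (E has_derivative (\<lambda>h. G y \<bullet> h)) (at y)"
    and G: "(G has_derivative H) (at x)"
  shows "u \<bullet> H w = H u \<bullet> w"
proof -
  have lin: "linear H" using G by (rule has_derivative_linear)
  define N where "N = norm u + norm w"
  define \<Delta> where "\<Delta> u w = E (x + u + w) - E (x + u) - E (x + w) + E x" for u w
  have one: "\<exists>d>0. \<forall>t. 0 < t \<and> t * N < d \<longrightarrow>
      \<bar>\<Delta> (t *\<^sub>R u) (t *\<^sub>R w) - t^2 * (u \<bullet> H w)\<bar> \<le> 2 * e * (t * N)^2"
    if e: "0 < e" and N: "norm u + norm w = N" for e u w
  proof -
    obtain d where d: "d > 0" and Gd: "\<And>h. norm h < d \<Longrightarrow> norm (G (x + h) - G x - H h) \<le> e * norm h"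
      using G e unfolding has_derivative_at_alt
      by (metis add_diff_cancel_left')
    have "\<bar>\<Delta> (t *\<^sub>R u) (t *\<^sub>R w) - t^2 * (u \<bullet> H w)\<bar> \<le> 2 * e * (t * N)^2" if t: "0 < t" "t * N < d" for t
    proof -
      define \<phi> where "\<phi> s = E (x + s *\<^sub>R (t *\<^sub>R u) + t *\<^sub>R w) - E (x + s *\<^sub>R (t *\<^sub>R u))" for s
      have line: "((\<lambda>s. E (x + s *\<^sub>R (t *\<^sub>R u) + c)) has_real_derivative
          G (x + s *\<^sub>R (t *\<^sub>R u) + c) \<bullet> (t *\<^sub>R u)) (at s)" for s c
      proof -
        have "((\<lambda>s. x + s *\<^sub>R (t *\<^sub>R u) + c) has_derivative (\<lambda>h. h *\<^sub>R (t *\<^sub>R u))) (at s)"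
          by (auto intro!: derivative_eq_intros)
        from has_derivative_compose[OF this E]
        show ?thesis unfolding has_field_derivative_def
          by (rule has_derivative_eq_rhs) (simp add: fun_eq_iff mult.commute)
      qed
      have der: "(\<phi> has_real_derivative
           (G (x + s *\<^sub>R (t *\<^sub>R u) + t *\<^sub>R w) - G (x + s *\<^sub>R (t *\<^sub>R u))) \<bullet> (t *\<^sub>R u)) (at s)" for s
        using DERIV_diff[OF line[of "t *\<^sub>R w" s] line[of 0 s]] by (simp add: \<phi>_def[abs_def] inner_diff_left right_diff_distrib)
      obtain s where s: "0 < s" "s < 1"
        and mvt: "\<phi> 1 - \<phi> 0 = (1 - 0) * ((G (x + s *\<^sub>R (t *\<^sub>R u) + t *\<^sub>R w) - G (x + s *\<^sub>R (t *\<^sub>R u))) \<bullet> (t *\<^sub>R u))"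
        using MVT2[of 0 1 \<phi>, OF _ der] by auto
      define h1 where "h1 = s *\<^sub>R (t *\<^sub>R u) + t *\<^sub>R w"
      define h2 where "h2 = s *\<^sub>R (t *\<^sub>R u)"
      have n2: "norm h2 \<le> t * norm u"
        using s t by (simp add: h2_def mult_left_le_one_le)
      then have n1: "norm h1 \<le> t * N"
        using norm_triangle_ineq[of h2 "t *\<^sub>R w"] t unfolding N[symmetric]
        by (simp add: h1_def h2_def distrib_left)
      have n2': "norm h2 \<le> t * N"
        using n2 t unfolding N[symmetric] by (smt (verit) mult_left_mono norm_ge_zero)
      have R1: "norm (G (x + h1) - G x - H h1) \<le> e * (t * N)"
        using Gd[of h1] n1 t e by (smt (verit) mult_left_mono)
      have R2: "norm (G (x + h2) - G x - H h2) \<le> e * (t * N)"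
        using Gd[of h2] n2' t e by (smt (verit) mult_left_mono)
      define R where "R = (G (x + h1) - G x - H h1) - (G (x + h2) - G x - H h2)"
      have R: "norm R \<le> 2 * e * (t * N)"
        unfolding R_def using norm_triangle_ineq4[of "G (x + h1) - G x - H h1" "G (x + h2) - G x - H h2"] R1 R2 by simp
      have "G (x + h1) - G (x + h2) = t *\<^sub>R H w + R"
        by (simp add: R_def h1_def h2_def linear_add[OF lin] linear_scale[OF lin])
      moreover have "\<Delta> (t *\<^sub>R u) (t *\<^sub>R w) = (G (x + h1) - G (x + h2)) \<bullet> (t *\<^sub>R u)"
        using mvt by (simp add: \<Delta>_def \<phi>_def h1_def h2_def add.assoc)
      ultimately have "\<Delta> (t *\<^sub>R u) (t *\<^sub>R w) - t^2 * (u \<bullet> H w) = R \<bullet> (t *\<^sub>R u)"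
        by (simp add: inner_add_left inner_add_right power2_eq_square inner_commute algebra_simps)
      moreover have "\<bar>R \<bullet> (t *\<^sub>R u)\<bar> \<le> (2 * e * (t * N)) * (t * N)"
      proof (rule order_trans[OF Cauchy_Schwarz_ineq2 mult_mono[OF R]])
        show "norm (t *\<^sub>R u) \<le> t * N" using t N by (auto intro!: mult_left_mono)
      qed (use e t N[symmetric] in auto)
      ultimately show ?thesis by (simp add: power2_eq_square)
    qed
    with d show ?thesis by blast
  qed
  have "\<bar>u \<bullet> H w - w \<bullet> H u\<bar> \<le> 4 * e * N^2" if e: "0 < e" for e
  proof -
    obtain d1 where d1: "d1 > 0" "\<And>t. 0 < t \<Longrightarrow> t * N < d1 \<Longrightarrow>
      \<bar>\<Delta> (t *\<^sub>R u) (t *\<^sub>R w) - t^2 * (u \<bullet> H w)\<bar> \<le> 2 * e * (t * N)^2"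
      using one[OF e, of u w] by (auto simp: N_def)
    obtain d2 where d2: "d2 > 0" "\<And>t. 0 < t \<Longrightarrow> t * N < d2 \<Longrightarrow>
      \<bar>\<Delta> (t *\<^sub>R w) (t *\<^sub>R u) - t^2 * (w \<bullet> H u)\<bar> \<le> 2 * e * (t * N)^2"
      using one[OF e, of w u] by (auto simp: N_def add.commute)
    have N0: "N \<ge> 0" by (simp add: N_def)
    define t where "t = min d1 d2 / (N + 1)"
    have t: "t > 0" using d1 d2 N0 by (simp add: t_def)
    have "t * (N + 1) = min d1 d2" using N0 by (simp add: t_def)
    then have "t * N < d1" "t * N < d2" using t by (auto simp: algebra_simps)
    note d1(2)[OF t this(1)] d2(2)[OF t this(2)]
    moreover have "\<Delta> (t *\<^sub>R w) (t *\<^sub>R u) = \<Delta> (t *\<^sub>R u) (t *\<^sub>R w)" by (simp add: \<Delta>_def algebra_simps)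
    ultimately have "\<bar>t^2 * (u \<bullet> H w) - t^2 * (w \<bullet> H u)\<bar> \<le> 4 * e * (t * N)^2" by linarith
    then have "\<bar>t^2 * (u \<bullet> H w - w \<bullet> H u)\<bar> \<le> t^2 * (4 * e * N^2)"
      by (simp add: power_mult_distrib algebra_simps)
    then have "t^2 * \<bar>u \<bullet> H w - w \<bullet> H u\<bar> \<le> t^2 * (4 * e * N^2)"
      by (simp add: abs_mult)
    then show ?thesis using t by simp
  qed
  note bd = this
  have "\<bar>u \<bullet> H w - w \<bullet> H u\<bar> \<le> 0 + e" if "0 < e" for e
  proof -
    have "\<bar>u \<bullet> H w - w \<bullet> H u\<bar> \<le> 4 * (e / (4 * (N^2 + 1))) * N^2"
      by (rule bd) (use that in \<open>simp add: add_nonneg_pos\<close>)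
    also have "\<dots> = e * (N^2 / (N^2 + 1))"
      using mult_divide_mult_cancel_left[of 4 "e * N^2" "N^2 + 1"] by simp
    also have "\<dots> \<le> e * 1"
      using that add_nonneg_pos[of "N^2" 1] by (intro mult_left_mono) (simp_all add: divide_le_eq)
    finally show ?thesis by simp
  qed
  then have "\<bar>u \<bullet> H w - w \<bullet> H u\<bar> \<le> 0" by (rule field_le_epsilon)
  then show ?thesis by (simp add: inner_commute)
qed

lemma twice_differentiable_grad:
  assumes "twice_differentiable E"
  shows "(E has_derivative (\<lambda>h. grad E x \<bullet> h)) (at x)"
proof -
  have d: "(E has_derivative frechet_derivative E (at x)) (at x)"
    using assms by (simp add: twice_differentiable_def frechet_derivative_works[symmetric])
  have "frechet_derivative E (at x) h = grad E x \<bullet> h" for h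
  proof -
    have lin: "linear (frechet_derivative E (at x))" using d by (rule has_derivative_linear)
    have "h = (\<Sum>i\<in>UNIV. h $ i *\<^sub>R axis i 1)"
      by (simp add: vec_eq_iff axis_def if_distrib[of "\<lambda>a. _ * a"] cong: if_cong)
    then have "frechet_derivative E (at x) h = frechet_derivative E (at x) (\<Sum>i\<in>UNIV. h $ i *\<^sub>R axis i 1)"
      by (rule arg_cong)
    also have "\<dots> = (\<Sum>i\<in>UNIV. h $ i *\<^sub>R frechet_derivative E (at x) (axis i 1))"
      by (simp only: linear_sum[OF lin] linear_scale[OF lin])
    finally show ?thesis by (simp add: grad_def inner_vec_def mult.commute)
  qed
  then show ?thesis using d by presburger
qed

lemma twice_differentiable_hessian:
  assumes "twice_differentiable E"
  shows "(grad E has_derivative (*v) (hessian E x)) (at x)"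
  using assms jacobian_works[of "grad E" "at x"] by (simp add: twice_differentiable_def hessian_def)

lemma selfadjoint_hessian:
  assumes "twice_differentiable E"
  shows "selfadjoint ((*v) (hessian E x))"
  using symmetric_second_derivative[OF twice_differentiable_grad[OF assms]
      twice_differentiable_hessian[OF assms]]
  by (auto simp: selfadjoint_def)

lemma norm_mult_vec_le_op_norm: "norm (A *v w) \<le> op_norm A * norm w"
  for A :: "real ^ 'n::finite ^ 'n"
  unfolding op_norm_def by (rule onorm) (simp add: linear_conv_bounded_linear[symmetric])

text \<open>
  The mean value inequality for \<open>z \<mapsto> grad E z - H\<^sub>* (z - xs)\<close> on the closed ball through \<open>y\<close>. It loses
  a factor \<open>2\<close> against the integral remainder, which \<open>C1\<close> has room for.
\<close>

lemma gradient_linearization: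
  fixes E :: "real ^ 'n::finite \<Rightarrow> real"
  assumes E: "twice_differentiable E" and g0: "grad E xs = 0" and M: "0 < M"
    and lip: "\<And>y. y \<in> ball xs \<delta> \<Longrightarrow> op_norm (hessian E y - hessian E xs) \<le> M * norm (y - xs)"
    and y: "y \<in> ball xs \<delta>"
  shows "norm (grad E y - hessian E xs *v (y - xs)) \<le> M * (norm (y - xs))^2"
proof -
  let ?S = "cball xs (norm (y - xs))"
  let ?f = "\<lambda>z. grad E z - hessian E xs *v (z - xs)"
  have "norm (?f y - ?f xs) \<le> (M * norm (y - xs)) * norm (y - xs)"
  proof (rule differentiable_bound[of ?S ?f "\<lambda>z. (*v) (hessian E z - hessian E xs)"])
    fix z assume z: "z \<in> ?S"
    show "(?f has_derivative (*v) (hessian E z - hessian E xs)) (at z within ?S)"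
    proof (rule has_derivative_at_withinI)
      have "((\<lambda>z. hessian E xs *v (z - xs)) has_derivative (\<lambda>h. hessian E xs *v h)) (at z)"
        by (rule has_derivative_compose[of "\<lambda>z. z - xs" "\<lambda>h. h"])
          (auto intro!: derivative_eq_intros linear_imp_has_derivative)
      from has_derivative_diff[OF twice_differentiable_hessian[OF E] this]
      show "(?f has_derivative (*v) (hessian E z - hessian E xs)) (at z)"
        by (simp add: matrix_vector_mult_diff_rdistrib[symmetric])
    qed
    have "norm (z - xs) \<le> norm (y - xs)" using z by (simp add: dist_norm norm_minus_commute)
    moreover have "z \<in> ball xs \<delta>" using z y by (auto simp: dist_norm norm_minus_commute)
    ultimately have "op_norm (hessian E z - hessian E xs) \<le> M * norm (y - xs)"
      using order_trans[OF lip[of z] mult_left_mono[of "norm (z - xs)" "norm (y - xs)" M]] M by simp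
    then show "onorm ((*v) (hessian E z - hessian E xs)) \<le> M * norm (y - xs)"
      unfolding op_norm_def .
  qed (auto simp: dist_norm norm_minus_commute)
  then show ?thesis by (simp add: g0 power2_eq_square)
qed

text \<open>
  With \<open>P\<close> the reflection at \<open>y\<close>, \<open>T = sgn H\<^sub>*\<close> and \<open>e = y - xs\<close>, the difference is
  \<open>P (grad E y - H\<^sub>* e) + (P - T) (H\<^sub>* e)\<close>, because \<open>|H\<^sub>*| = T H\<^sub>*\<close>. The first term is bounded by
  the linearization error, as \<open>P\<close> is a contraction, and the second by the perturbation bound for
  the sign.
\<close>

lemma reflected_gradient_linearization:
  fixes E :: "real ^ 'n::finite \<Rightarrow> real"
  assumes E: "twice_differentiable E" and g0: "grad E xs = 0"
    and M: "0 < M" and mu: "0 < \<mu>" and muL: "\<mu> \<le> L" and k: "k \<le> CARD('n)"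
    and lip: "\<And>z. z \<in> ball xs \<delta> \<Longrightarrow> op_norm (hessian E z - hessian E xs) \<le> M * norm (z - xs)"
    and spec: "\<And>z. z \<in> ball xs \<delta> \<Longrightarrow> saddle_spectrum (hessian E z) k \<mu> L"
    and C: "eigenbasis ((*v) (hessian E xs)) C"
    and y: "y \<in> ball xs \<delta>"
    and v: "orthonormal_family k v" "bij_betw p {1..k} {1..k}"
      "\<And>i. i \<in> {1..k} \<Longrightarrow> hessian E y *v v i = eigval (hessian E y) (p i) *\<^sub>R v i"
  shows "norm (reflection k v *v grad E y
      - spectral_map C (\<lambda>c. \<bar>rayleigh ((*v) (hessian E xs)) c\<bar>) (y - xs))
    \<le> (1 + L / \<mu>) * M * (norm (y - xs))\<^sup>2"
proof -
  let ?H = "hessian E"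
  note sa = selfadjoint_hessian[OF E]
  have xs: "xs \<in> ball xs \<delta>" using y by (smt (verit) centre_in_ball mem_ball zero_le_dist)
  obtain B where B: "eigenbasis ((*v) (?H y)) B"
    and refl: "\<And>w. reflection k v *v w = spectral_map B (\<lambda>b. sgn (rayleigh ((*v) (?H y)) b)) w"
    using reflection_eq_sign[OF sa mu k spec[OF y] v] by metis
  define e where "e = y - xs"
  let ?r = "rayleigh ((*v) (?H xs))"
  define T where "T = spectral_map C (\<lambda>c. sgn (?r c))"
  note B' = eigenbasisD(1,2)[OF B] and C' = eigenbasisD(1,2)[OF C]
  note bB = eigenbasis_count(2)[OF B k spec[OF y]] and bC = eigenbasis_count(2)[OF C k spec[OF xs]]
  have D: "norm (?H y *v w - ?H xs *v w) \<le> (M * norm e) * norm w" for w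
  proof -
    have "norm ((?H y - ?H xs) *v w) \<le> op_norm (?H y - ?H xs) * norm w" by (rule norm_mult_vec_le_op_norm)
    also have "\<dots> \<le> (M * norm e) * norm w" using lip[OF y] by (simp add: e_def mult_right_mono)
    finally show ?thesis by (simp add: matrix_vector_mult_diff_rdistrib)
  qed
  have PT: "norm (reflection k v *v w - T w) \<le> (M * norm e) / \<mu> * norm w" for w
    unfolding refl T_def
    by (rule sign_perturbation[OF sa B sa C _ _ mu D]) (use bB bC in auto)
  have P1: "norm (reflection k v *v w) \<le> norm w" for w
    using norm_spectral_map_le[OF B', of "\<lambda>b. sgn (rayleigh ((*v) (?H y)) b)" 1 w]
    by (auto simp: refl sgn_if)
  have Hs: "norm (?H xs *v e) \<le> L * norm e"
    using norm_spectral_map_le[OF C', of ?r L e] bC mu muL eigenbasis_spectral_map[OF sa C, of e] by auto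
  have abs: "spectral_map C (\<lambda>c. \<bar>?r c\<bar>) e = T (?H xs *v e)"
    using spectral_map_compose[OF C', of "\<lambda>b. sgn (?r b)" ?r e] eigenbasis_spectral_map[OF sa C, of e]
    by (simp add: T_def abs_sgn mult.commute)
  have "norm (reflection k v *v grad E y - T (?H xs *v e))
    = norm (reflection k v *v (grad E y - ?H xs *v e) + (reflection k v *v (?H xs *v e) - T (?H xs *v e)))"
    by (simp add: matrix_vector_mult_diff_distrib)
  also have "\<dots> \<le> norm (grad E y - ?H xs *v e) + (M * norm e) / \<mu> * norm (?H xs *v e)"
    by (rule order_trans[OF norm_triangle_ineq add_mono[OF P1 PT]])
  also have "\<dots> \<le> M * (norm e)\<^sup>2 + (M * norm e) / \<mu> * (L * norm e)"
    using gradient_linearization[OF E g0 M lip y] Hs mu M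
    by (intro add_mono mult_left_mono) (auto simp: e_def)
  also have "\<dots> = (1 + L / \<mu>) * M * (norm e)\<^sup>2"
    by (simp add: power2_eq_square algebra_simps)
  finally show ?thesis using abs by (simp add: e_def)
qed

section \<open>The momentum recurrence\<close>

text \<open>
  The Lucas sequence \<open>U\<^sub>n(p, \<gamma>)\<close>, the response of the momentum recurrence to a unit impulse.
\<close>

fun momentum_kernel :: "real \<Rightarrow> real \<Rightarrow> nat \<Rightarrow> real" where
  "momentum_kernel p \<gamma> 0 = 0"
| "momentum_kernel p \<gamma> (Suc 0) = 1"
| "momentum_kernel p \<gamma> (Suc (Suc n)) = p * momentum_kernel p \<gamma> (Suc n) - \<gamma> * momentum_kernel p \<gamma> n"

text \<open>
  A quadratic form that the recurrence multiplies by \<open>\<gamma>\<close> in each step. It replaces the formula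
  \<open>\<rho>\<^sup>n\<^sup>-\<^sup>1 sin(n\<phi>) / sin \<phi>\<close> for complex characteristic roots \<open>\<rho> exp(\<plusminus>i\<phi>)\<close>.
\<close>

lemma momentum_kernel_invariant:
  "(momentum_kernel p \<gamma> (Suc n))^2 - p * momentum_kernel p \<gamma> (Suc n) * momentum_kernel p \<gamma> n
    + \<gamma> * (momentum_kernel p \<gamma> n)^2 = \<gamma> ^ n"
proof (induction n)
  case (Suc n)
  have "(momentum_kernel p \<gamma> (Suc (Suc n)))^2 - p * momentum_kernel p \<gamma> (Suc (Suc n)) * momentum_kernel p \<gamma> (Suc n)
      + \<gamma> * (momentum_kernel p \<gamma> (Suc n))^2 =
    \<gamma> * ((momentum_kernel p \<gamma> (Suc n))^2 - p * momentum_kernel p \<gamma> (Suc n) * momentum_kernel p \<gamma> n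
    + \<gamma> * (momentum_kernel p \<gamma> n)^2)"
    by (simp add: power2_eq_square algebra_simps)
  then show ?case using Suc by simp
qed simp

text \<open>
  The square \<open>\<gamma> - p\<^sup>2/4\<close> of the imaginary part of the roots is positive, so the invariant form is
  positive definite. Completing the square bounds the kernel.
\<close>

lemma momentum_kernel_bound:
  assumes g: "0 \<le> \<rho>" "\<gamma> = \<rho>\<^sup>2" and \<omega>: "0 < \<omega>" "\<omega>\<^sup>2 \<le> \<gamma> - p\<^sup>2 / 4"
  shows "\<bar>momentum_kernel p \<gamma> n\<bar> \<le> \<rho> ^ n / \<omega>"
proof -
  let ?g = "momentum_kernel p \<gamma>"
  have "(\<omega> * ?g n)^2 \<le> (\<gamma> - p^2 / 4) * (?g n)^2"
    using mult_right_mono[OF \<omega>(2), of "(?g n)^2"] by (simp add: power_mult_distrib)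
  also have "\<dots> \<le> (?g (Suc n) - p / 2 * ?g n)^2 + (\<gamma> - p^2 / 4) * (?g n)^2" by simp
  also have "\<dots> = \<gamma> ^ n"
    unfolding momentum_kernel_invariant[of p \<gamma> n, symmetric] by (simp add: power2_eq_square field_simps)
  also have "\<dots> = (\<rho> ^ n)^2" using g by (simp add: power_mult[symmetric] mult.commute)
  finally have "\<bar>\<omega> * ?g n\<bar> \<le> \<rho> ^ n" using g by (simp add: abs_le_square_iff[symmetric] power2_le_iff_abs_le)
  then show ?thesis using \<omega> by (simp add: abs_mult pos_le_divide_eq mult.commute)
qed

text \<open>
  Variation of constants. The value before the initial one is set equal to \<open>a 0\<close>, which makes the
  homogeneous part \<open>U\<^sub>n\<^sub>+\<^sub>1 - \<gamma> U\<^sub>n\<close>.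
\<close>

lemma momentum_recurrence_solution:
  fixes a h :: "nat \<Rightarrow> real"
  assumes rec: "\<And>n. a (Suc n) = p * a n - \<gamma> * (if n = 0 then a 0 else a (n - 1)) + h n"
  shows "a n = (momentum_kernel p \<gamma> (Suc n) - \<gamma> * momentum_kernel p \<gamma> n) * a 0
    + (\<Sum>j<n. momentum_kernel p \<gamma> (n - j) * h j)"
proof (induction n rule: less_induct)
  case (less n)
  let ?g = "momentum_kernel p \<gamma>"
  have three: "n = 0 \<or> n = 1 \<or> (\<exists>m. n = Suc (Suc m))" by presburger
  from three consider "n = 0" | "n = 1" | m where "n = Suc (Suc m)" by blast
  then show ?case
  proof cases
    case 3
    have I1: "a (Suc m) = (?g (Suc (Suc m)) - \<gamma> * ?g (Suc m)) * a 0 + (\<Sum>j<Suc m. ?g (Suc m - j) * h j)"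
      and I2: "a m = (?g (Suc m) - \<gamma> * ?g m) * a 0 + (\<Sum>j<m. ?g (m - j) * h j)"
      using less[of "Suc m"] less[of m] 3 by simp_all
    have "(\<Sum>j<m. ?g (Suc (Suc m) - j) * h j) = (\<Sum>j<m. p * (?g (Suc m - j) * h j) - \<gamma> * (?g (m - j) * h j))"
    proof (intro sum.cong refl)
      fix j assume "j \<in> {..<m}"
      then have "Suc (Suc m) - j = Suc (Suc (m - j))" "Suc m - j = Suc (m - j)" by auto
      then show "?g (Suc (Suc m) - j) * h j = p * (?g (Suc m - j) * h j) - \<gamma> * (?g (m - j) * h j)"
        by (simp add: algebra_simps)
    qed
    then have S: "(\<Sum>j<m. ?g (Suc (Suc m) - j) * h j) = p * (\<Sum>j<m. ?g (Suc m - j) * h j) - \<gamma> * (\<Sum>j<m. ?g (m - j) * h j)"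
      by (simp add: sum_subtractf sum_distrib_left)
    have "(\<Sum>j<n. ?g (n - j) * h j) = h (Suc m) + p * (\<Sum>j<Suc m. ?g (Suc m - j) * h j) - \<gamma> * (\<Sum>j<m. ?g (m - j) * h j)"
      unfolding 3 using S by (simp add: Suc_diff_le numeral_2_eq_2 algebra_simps)
    moreover have "a n = p * a (Suc m) - \<gamma> * a m + h (Suc m)" using rec[of "Suc m"] 3 by simp
    ultimately show ?thesis unfolding I1 I2 3 by (simp add: algebra_simps)
  qed (use rec[of 0] in \<open>simp_all add: algebra_simps\<close>)
qed

text \<open>
  Here \<open>s = \<surd>\<kappa> + 1\<close> and \<open>y = \<beta>\<lambda>\<close>; the bounds on \<open>y\<close> are the values at \<open>\<lambda> = \<mu>\<close> and \<open>\<lambda> = L\<close>, namely \<open>(1 - q)\<^sup>2\<close>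
  and \<open>(1 + q)\<^sup>2\<close> for \<open>q = 1 - 2/s\<close>. The squared imaginary part of the roots factors as
  \<open>(y - (1 - \<rho>)\<^sup>2) ((1 + \<rho>)\<^sup>2 - y) / 4\<close>. Choosing \<open>\<rho> = q + \<epsilon>\<close> slightly above \<open>q\<close> keeps both factors
  positive, at least \<open>3\<epsilon>/s\<close> and \<open>2\<epsilon>\<close>.
\<close>

lemma momentum_kernel_bound_tuned:
  fixes s \<epsilon> \<rho> y :: real
  assumes s: "2 \<le> s" and \<epsilon>: "0 < \<epsilon>" "\<epsilon> < 1 / s" and \<rho>: "\<rho> = 1 - 2 / s + \<epsilon>"
    and y: "(2 / s)\<^sup>2 \<le> y" "y \<le> (2 * (s - 1) / s)\<^sup>2"
  shows "\<bar>momentum_kernel (1 + \<rho>\<^sup>2 - y) (\<rho>\<^sup>2) n\<bar> \<le> sqrt 2 * sqrt s / (sqrt 3 * \<epsilon>) * \<rho> ^ n"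
proof -
  define \<omega> where "\<omega> = sqrt 3 * \<epsilon> / (sqrt 2 * sqrt s)"
  have \<rho>0: "0 \<le> \<rho>" using s \<epsilon> \<rho> by simp
  have lo: "\<epsilon> * (3 / s) \<le> y - (1 - \<rho>)\<^sup>2"
  proof -
    have "\<epsilon> * (3 / s) \<le> \<epsilon> * (4 / s - \<epsilon>)" using \<epsilon> by (intro mult_left_mono) auto
    also have "\<dots> = (2 / s)\<^sup>2 - (1 - \<rho>)\<^sup>2" unfolding \<rho> by (simp add: power2_eq_square algebra_simps)
    finally show ?thesis using y by simp
  qed
  have hi: "\<epsilon> * 2 \<le> (1 + \<rho>)\<^sup>2 - y"
  proof -
    have *: "2 * (s - 1) / s = 1 + \<rho> - \<epsilon>" using s by (simp add: \<rho> field_simps)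
    have "\<epsilon> \<le> \<rho>" using s \<rho> by simp
    then have "\<epsilon> * 2 \<le> \<epsilon> * (2 * (1 + \<rho>) - \<epsilon>)" using \<epsilon> by (intro mult_left_mono) auto
    also have "\<dots> = (1 + \<rho>)\<^sup>2 - (1 + \<rho> - \<epsilon>)\<^sup>2" by (simp add: power2_eq_square algebra_simps)
    finally show ?thesis using y unfolding * by simp
  qed
  have "\<omega>\<^sup>2 = 3 * \<epsilon>\<^sup>2 / (2 * s)"
    using s by (simp add: \<omega>_def power_divide power_mult_distrib)
  also have "\<dots> = (\<epsilon> * (3 / s)) * (\<epsilon> * 2) / 4" by (simp add: power2_eq_square)
  also have "\<dots> \<le> (y - (1 - \<rho>)\<^sup>2) * ((1 + \<rho>)\<^sup>2 - y) / 4"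
  proof (intro divide_right_mono mult_mono lo hi)
    have "0 \<le> \<epsilon> * (3 / s)" using \<epsilon> s by simp
    then show "0 \<le> y - (1 - \<rho>)\<^sup>2" using lo by linarith
  qed (use \<epsilon> in auto)
  also have "\<dots> = \<rho>\<^sup>2 - (1 + \<rho>\<^sup>2 - y)\<^sup>2 / 4"
    by (simp add: power2_eq_square field_simps)
  finally have "\<omega>\<^sup>2 \<le> \<rho>\<^sup>2 - (1 + \<rho>\<^sup>2 - y)\<^sup>2 / 4" .
  from momentum_kernel_bound[OF \<rho>0 refl _ this, of n] show ?thesis
    using \<epsilon> s by (simp add: \<omega>_def mult.commute)
qed

section \<open>Heavy ball iteration with a quadratic perturbation\<close>

text \<open>
  The geometric sum with ratio \<open>\<rho>/\<theta>\<close>, stated without division.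
\<close>

lemma geometric_convolution:
  fixes \<rho> \<theta> :: real
  shows "(\<theta> - \<rho>) * (\<Sum>j<n. \<rho> ^ (n - j) * \<theta> ^ j) = \<rho> * (\<theta> ^ n - \<rho> ^ n)"
proof (induction n)
  case (Suc n)
  have "(\<Sum>j<n. \<rho> ^ (Suc n - j) * \<theta> ^ j) = \<rho> * (\<Sum>j<n. \<rho> ^ (n - j) * \<theta> ^ j)"
    unfolding sum_distrib_left by (intro sum.cong) (auto simp: Suc_diff_le)
  then have "(\<theta> - \<rho>) * (\<Sum>j<Suc n. \<rho> ^ (Suc n - j) * \<theta> ^ j)
    = \<rho> * ((\<theta> - \<rho>) * (\<Sum>j<n. \<rho> ^ (n - j) * \<theta> ^ j)) + (\<theta> - \<rho>) * (\<rho> * \<theta> ^ n)"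
    by (simp add: algebra_simps)
  also have "\<dots> = \<rho> * (\<theta> ^ Suc n - \<rho> ^ Suc n)"
    unfolding Suc.IH by (simp add: algebra_simps)
  finally show ?case .
qed simp

text \<open>
  Each coordinate in the basis \<open>B\<close> satisfies a scalar momentum recurrence. The scalar solutions
  reassemble into spectral maps, and these inherit the uniform bound on their coefficients. The
  homogeneous part costs a factor \<open>2\<close>, since \<open>\<rho>\<^sup>n\<^sup>+\<^sup>1 + \<gamma> \<rho>\<^sup>n \<le> 2 \<rho>\<^sup>n\<close>.
\<close>

lemma perturbed_heavy_ball_duhamel:
  fixes e \<eta> :: "nat \<Rightarrow> 'a::euclidean_space"
  assumes on: "orthonormal B" "span B = UNIV"
    and rec: "\<And>n. e (Suc n) = e n - \<beta> *\<^sub>R spectral_map B lam (e n)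
      + \<gamma> *\<^sub>R (e n - (if n = 0 then e 0 else e (n - 1))) + \<eta> n"
    and ker: "\<And>b n. b \<in> B \<Longrightarrow> \<bar>momentum_kernel (1 + \<gamma> - \<beta> * lam b) \<gamma> n\<bar> \<le> c * \<rho> ^ n"
    and \<rho>: "0 \<le> \<rho>" "\<rho> \<le> 1" "\<gamma> = \<rho>\<^sup>2" and c: "0 \<le> c"
  shows "norm (e n) \<le> 2 * c * \<rho> ^ n * norm (e 0) + (\<Sum>j<n. c * \<rho> ^ (n - j) * norm (\<eta> j))"
proof -
  define g where "g m b = momentum_kernel (1 + \<gamma> - \<beta> * lam b) \<gamma> m" for m b
  have "e n = spectral_map B (\<lambda>b. g (Suc n) b - \<gamma> * g n b) (e 0)
    + (\<Sum>j<n. spectral_map B (g (n - j)) (\<eta> j))"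
  proof (rule orthonormal_ext[OF on])
    fix b assume b: "b \<in> B"
    have "b \<bullet> e (Suc n) = (1 + \<gamma> - \<beta> * lam b) * (b \<bullet> e n)
        - \<gamma> * (if n = 0 then b \<bullet> e 0 else b \<bullet> e (n - 1)) + b \<bullet> \<eta> n" for n
      by (subst rec) (simp add: inner_add_right inner_diff_right inner_spectral_map[OF on b] algebra_simps)
    from momentum_recurrence_solution[of "\<lambda>n. b \<bullet> e n", OF this, of n]
    show "b \<bullet> e n = b \<bullet> (spectral_map B (\<lambda>b. g (Suc n) b - \<gamma> * g n b) (e 0)
      + (\<Sum>j<n. spectral_map B (g (n - j)) (\<eta> j)))"
      by (simp add: inner_add_right inner_sum_right inner_spectral_map[OF on b] g_def)
  qed
  also have "norm \<dots> \<le> norm (spectral_map B (\<lambda>b. g (Suc n) b - \<gamma> * g n b) (e 0))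
    + (\<Sum>j<n. norm (spectral_map B (g (n - j)) (\<eta> j)))"
    by (intro order_trans[OF norm_triangle_ineq] add_left_mono norm_sum)
  also have "\<dots> \<le> 2 * c * \<rho> ^ n * norm (e 0) + (\<Sum>j<n. c * \<rho> ^ (n - j) * norm (\<eta> j))"
  proof (intro add_mono sum_mono norm_spectral_map_le[OF on])
    fix b assume b: "b \<in> B"
    have "\<bar>g (Suc n) b - \<gamma> * g n b\<bar> \<le> c * \<rho> ^ Suc n + \<gamma> * (c * \<rho> ^ n)"
      using ker[OF b, of "Suc n"] mult_left_mono[OF ker[OF b, of n], of \<gamma>] \<rho>
        abs_triangle_ineq4[of "g (Suc n) b" "\<gamma> * g n b"] by (simp add: g_def abs_mult)
    also have "\<dots> = (\<rho> + \<rho>\<^sup>2) * (c * \<rho> ^ n)" using \<rho>(3) by (simp add: algebra_simps)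
    also have "\<dots> \<le> 2 * (c * \<rho> ^ n)"
      using \<rho> c power_le_one[of \<rho> 2] by (intro mult_right_mono) auto
    finally show "\<bar>g (Suc n) b - \<gamma> * g n b\<bar> \<le> 2 * c * \<rho> ^ n" by simp
  qed (use ker \<rho> c in \<open>auto simp: g_def\<close>)
  finally show ?thesis .
qed

text \<open>
  By induction, \<open>\<parallel>\<eta> j\<parallel> \<le> q R\<^sup>2 \<theta>\<^sup>2\<^sup>j \<le> q R\<^sup>2 \<theta>\<^sup>j\<close> for \<open>j < n\<close>. One factor \<open>\<theta>\<^sup>j\<close> is given away because the
  rest already makes a geometric sum of size \<open>\<theta>\<^sup>n \<rho>/(\<theta> - \<rho>)\<close>. The bound \<open>R\<close> is \<open>2\<surd>2\<close> times the initial
  term \<open>2 c \<parallel>e 0\<parallel>\<close>, which leaves room for the perturbation.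
\<close>

lemma perturbed_heavy_ball_convergence:
  fixes e \<eta> :: "nat \<Rightarrow> 'a::euclidean_space"
  assumes duh: "\<And>n. norm (e n) \<le> 2 * c * \<rho> ^ n * norm (e 0) + (\<Sum>j<n. c * \<rho> ^ (n - j) * norm (\<eta> j))"
    and \<eta>: "\<And>n. norm (e n) < \<delta> \<Longrightarrow> norm (\<eta> n) \<le> q * (norm (e n))\<^sup>2"
    and \<rho>: "0 \<le> \<rho>" "\<rho> < \<theta>" "\<theta> \<le> 1" and c: "0 \<le> c" and q: "0 \<le> q"
    and R: "R = 4 * sqrt 2 * c * norm (e 0)" "R < \<delta>"
    and small: "c * q * R * \<rho> \<le> (\<theta> - \<rho>) / 4"
  shows "norm (e n) \<le> R * \<theta> ^ n"
proof (induction n rule: less_induct)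
  case (less n)
  have R0: "0 \<le> R" using R(1) c by simp
  have "norm (\<eta> j) \<le> q * (R\<^sup>2 * \<theta> ^ j)" if "j < n" for j
  proof -
    have ej: "norm (e j) \<le> R * \<theta> ^ j" using less[OF that] .
    also have "\<dots> \<le> R" using R0 \<rho> by (simp add: mult_left_le power_le_one)
    finally have "norm (e j) < \<delta>" using R by simp
    then have "norm (\<eta> j) \<le> q * (norm (e j))\<^sup>2" by (rule \<eta>)
    also have "(norm (e j))\<^sup>2 \<le> (R * \<theta> ^ j)\<^sup>2" using ej by (intro power_mono) auto
    also have "(R * \<theta> ^ j)\<^sup>2 = R\<^sup>2 * (\<theta> ^ j * \<theta> ^ j)" by (simp add: power2_eq_square)
    also have "\<dots> \<le> R\<^sup>2 * (\<theta> ^ j * 1)" using \<rho> by (intro mult_left_mono) (auto simp: power_le_one)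
    finally show ?thesis using q by (simp add: mult_left_mono)
  qed
  then have "(\<Sum>j<n. c * \<rho> ^ (n - j) * norm (\<eta> j)) \<le> (\<Sum>j<n. c * \<rho> ^ (n - j) * (q * (R\<^sup>2 * \<theta> ^ j)))"
    using c \<rho> by (intro sum_mono mult_left_mono) auto
  also have "\<dots> = c * q * R\<^sup>2 * (\<Sum>j<n. \<rho> ^ (n - j) * \<theta> ^ j)"
    unfolding sum_distrib_left by (simp add: algebra_simps)
  also have "\<dots> \<le> R * \<theta> ^ n / 4"
  proof -
    have "(\<theta> - \<rho>) * (c * q * R\<^sup>2 * (\<Sum>j<n. \<rho> ^ (n - j) * \<theta> ^ j)) = c * q * R\<^sup>2 * (\<rho> * (\<theta> ^ n - \<rho> ^ n))"
      unfolding geometric_convolution[symmetric] by simp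
    also have "\<dots> \<le> c * q * R\<^sup>2 * (\<rho> * \<theta> ^ n)"
      using c q \<rho> by (intro mult_left_mono) auto
    also have "\<dots> = (c * q * R * \<rho>) * (R * \<theta> ^ n)" by (simp add: power2_eq_square)
    also have "\<dots> \<le> (\<theta> - \<rho>) / 4 * (R * \<theta> ^ n)"
      using small R0 \<rho> by (intro mult_right_mono) auto
    also have "\<dots> = (\<theta> - \<rho>) * (R * \<theta> ^ n / 4)" by simp
    finally show ?thesis using \<rho> by (simp only: mult_le_cancel_left_pos[of "\<theta> - \<rho>"] diff_gt_0_iff_gt)
  qed
  finally have 1: "(\<Sum>j<n. c * \<rho> ^ (n - j) * norm (\<eta> j)) \<le> R * \<theta> ^ n / 4" .
  have "2 * c * \<rho> ^ n * norm (e 0) \<le> 2 * c * \<theta> ^ n * norm (e 0)"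
    using \<rho> c by (intro mult_right_mono mult_left_mono power_mono) auto
  also have "\<dots> \<le> R * \<theta> ^ n / 2"
    using real_sqrt_ge_1_iff[of 2] mult_right_mono[of 1 "sqrt 2" "2 * c * \<theta> ^ n * norm (e 0)"] c \<rho> unfolding R(1)
    by (simp add: algebra_simps)
  finally have 2: "2 * c * \<rho> ^ n * norm (e 0) \<le> R * \<theta> ^ n / 2" .
  have "0 \<le> R * \<theta> ^ n" using R0 \<rho> by simp
  then show ?case using duh[of n] 1 2 by linarith
qed

section \<open>Local convergence to the saddle point\<close>

theorem theorem4:
  fixes E :: "real ^ 'n::finite \<Rightarrow> real"
    and k :: nat
    and xs :: "real ^ 'n"
    and x :: "nat \<Rightarrow> real ^ 'n"
    and v :: "nat \<Rightarrow> nat \<Rightarrow> real ^ 'n"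
    and \<delta> M \<mu> L \<kappa> \<epsilon> \<beta> \<gamma> K C1 r \<theta> :: real
  assumes "twice_differentiable E"
    and "1 \<le> k" and "k \<le> CARD('n)"
    and "nondegenerate_saddle E k xs"
    and "ahisd E k \<beta> \<gamma> x v"
    and "assumption_I E k xs (x 0) \<delta> M \<mu> L"
    and "assumption_II E k x v"
    and "\<kappa> = L / \<mu>"
    and "0 < \<epsilon>" and "\<epsilon> < 1 / (sqrt \<kappa> + 1)"
    and "sqrt \<beta> = 2 / (sqrt L + sqrt \<mu>)"
    and "sqrt \<gamma> = 1 - 2 / (sqrt \<kappa> + 1) + \<epsilon>"
    and "K = 2 * sqrt 2 * (sqrt \<kappa> + 1) powr (1/2) / (sqrt 3 * \<epsilon>)"
    and "C1 = (2 * sqrt (2 * real k) * L / \<mu> + 1/2) * M"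
    and "0 < r"
    and "r < min \<delta> (sqrt 3 * \<mu> * \<epsilon>\<^sup>2 * (sqrt \<kappa> + 1) powr (3/2) / (16 * sqrt 2 * C1))"
    and "norm (x 0 - xs) \<le> r / (2 * sqrt 2 * K)"
    and "\<theta> = 1 - 2 / (sqrt \<kappa> + 1) + 2 * \<epsilon>"
  shows "x \<longlonglongrightarrow> xs \<and> (\<forall>n. norm (x n - xs) \<le> 2 * sqrt 2 * K * norm (x 0 - xs) * \<theta> ^ n)"
proof -
  note E = assms(1) and eps = assms(9,10)
  have g0: "grad E xs = 0" using assms(4) by (simp add: nondegenerate_saddle_def)
  have I: "\<delta> > 0" "M > 0" "0 < \<mu>" "\<mu> < L"
    and lip: "\<And>y. y \<in> ball xs \<delta> \<Longrightarrow> op_norm (hessian E y - hessian E xs) \<le> M * norm (y - xs)"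
    and spec: "\<And>y. y \<in> ball xs \<delta> \<Longrightarrow> saddle_spectrum (hessian E y) k \<mu> L"
    using assms(6) by (auto simp: assumption_I_def saddle_spectrum_def)
  define s where "s = sqrt \<kappa> + 1"
  define \<rho> where "\<rho> = 1 - 2 / s + \<epsilon>"
  \<comment> \<open>the bound on the momentum kernel, equal to \<open>K / 2\<close>\<close>
  define c where "c = sqrt 2 * sqrt s / (sqrt 3 * \<epsilon>)"
  have s2: "2 < s" using I assms(8) by (simp add: s_def)
  have eps': "0 < \<epsilon>" "\<epsilon> < 1 / s" using eps by (auto simp: s_def)
  have \<rho>0: "0 < \<rho>" using s2 eps' by (simp add: \<rho>_def add_nonneg_pos)
  have \<rho>1: "\<rho> < 1" using s2 eps' by (simp add: \<rho>_def)
  have \<theta>: "\<theta> = \<rho> + \<epsilon>" using assms(18) by (simp add: \<rho>_def s_def)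
  have \<theta>1: "\<theta> < 1" using eps' by (simp add: \<theta> \<rho>_def)
  have c0: "0 < c" using s2 eps' by (simp add: c_def)
  have K: "K = 2 * c" using s2 assms(13) by (simp add: c_def s_def powr_half_sqrt)
  have \<gamma>: "\<gamma> = \<rho>\<^sup>2"
  proof -
    have sq: "sqrt \<gamma> = \<rho>" using assms(12) by (simp add: \<rho>_def s_def)
    then have "0 \<le> \<gamma>" using \<rho>0 by (metis real_sqrt_le_0_iff linorder_not_le less_imp_le)
    then show ?thesis using sq by (metis real_sqrt_pow2)
  qed
  have sqL: "sqrt L = (s - 1) * sqrt \<mu>"
    using I by (simp add: s_def assms(8) flip: real_sqrt_mult)
  have \<beta>: "\<beta> = 4 / (\<mu> * s\<^sup>2)"
  proof -
    have sq: "sqrt \<beta> = 2 / (s * sqrt \<mu>)" unfolding assms(11) sqL by (simp add: algebra_simps)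
    then have "0 < sqrt \<beta>" using I s2 by simp
    then have "\<beta> = (sqrt \<beta>)\<^sup>2" by simp
    also have "\<dots> = 4 / (\<mu> * s\<^sup>2)" using I unfolding sq by (simp add: power_divide power_mult_distrib)
    finally show ?thesis .
  qed
  have \<beta>0: "0 < \<beta>" using I s2 by (simp add: \<beta>)
  have L: "L = (s - 1)\<^sup>2 * \<mu>"
    using I arg_cong[OF sqL, of "\<lambda>a. a\<^sup>2"] by (simp add: power_mult_distrib)
  let ?r = "rayleigh ((*v) (hessian E xs))"
  note sa = selfadjoint_hessian[OF E, of xs]
  obtain C where C: "eigenbasis ((*v) (hessian E xs)) C"
    using selfadjoint_extend_eigenbasis[OF sa, of "{}"] by (auto simp: orthonormal_def)
  note C' = eigenbasisD(1,2)[OF C]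
  have xs: "xs \<in> ball xs \<delta>" using I by simp
  have ker: "\<bar>momentum_kernel (1 + \<gamma> - \<beta> * \<bar>?r b\<bar>) \<gamma> n\<bar> \<le> c * \<rho> ^ n" if b: "b \<in> C" for b n
  proof -
    have r: "\<mu> \<le> \<bar>?r b\<bar>" "\<bar>?r b\<bar> \<le> L"
      using eigenbasis_count(2)[OF C assms(3) spec[OF xs] b] by auto
    have "(2 / s)\<^sup>2 = \<beta> * \<mu>" using I by (simp add: \<beta> power_divide)
    then have lo: "(2 / s)\<^sup>2 \<le> \<beta> * \<bar>?r b\<bar>" using r \<beta>0 by simp
    have "(2 * (s - 1) / s)\<^sup>2 = 4 * (s - 1)\<^sup>2 / s\<^sup>2" unfolding power_divide power_mult_distrib by simp
    also have "\<dots> = \<beta> * L" using I by (simp add: \<beta> L)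
    finally have hi: "\<beta> * \<bar>?r b\<bar> \<le> (2 * (s - 1) / s)\<^sup>2" using r \<beta>0 by simp
    show ?thesis unfolding \<gamma> c_def
      by (rule momentum_kernel_bound_tuned[OF _ eps' \<rho>_def lo hi]) (use s2 in simp)
  qed
  define e where "e n = x n - xs" for n
  define \<eta> where "\<eta> n = - \<beta> *\<^sub>R (reflection k (v n) *v grad E (x n) - spectral_map C (\<lambda>c. \<bar>?r c\<bar>) (e n))" for n
  have rec: "e (Suc n) = e n - \<beta> *\<^sub>R spectral_map C (\<lambda>c. \<bar>?r c\<bar>) (e n)
      + \<gamma> *\<^sub>R (e n - (if n = 0 then e 0 else e (n - 1))) + \<eta> n" for n
  proof -
    have "x (Suc n) = x n - \<beta> *\<^sub>R (reflection k (v n) *v grad E (x n))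
                      + \<gamma> *\<^sub>R (x n - (if n = 0 then x 0 else x (n - 1)))"
      using assms(5) unfolding ahisd_def by blast
    then show ?thesis by (cases "n = 0") (simp_all add: e_def \<eta>_def algebra_simps)
  qed
  have C1: "(1 + L / \<mu>) * M \<le> C1"
  proof -
    have "1 \<le> sqrt (2 * real k)" using assms(2) by simp
    then have "2 * (L / \<mu>) \<le> 2 * sqrt (2 * real k) * (L / \<mu>)" using I by (intro mult_right_mono) auto
    moreover have "1 \<le> L / \<mu>" using I by simp
    ultimately have "1 + L / \<mu> \<le> 2 * sqrt (2 * real k) * L / \<mu> + 1/2" by simp
    then show ?thesis unfolding assms(14) using I by (intro mult_right_mono) auto
  qed
  have C10: "0 < C1" using I by (intro less_le_trans[OF _ C1]) (simp add: add_pos_pos)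
  have \<eta>: "norm (\<eta> n) \<le> \<beta> * C1 * (norm (e n))\<^sup>2" if "norm (e n) < \<delta>" for n
  proof -
    have y: "x n \<in> ball xs \<delta>" using that by (simp add: e_def dist_norm norm_minus_commute)
    obtain p where v: "orthonormal_family k (v n)" "bij_betw p {1..k} {1..k}"
      "\<And>i. i \<in> {1..k} \<Longrightarrow> hessian E (x n) *v v n i = eigval (hessian E (x n)) (p i) *\<^sub>R v n i"
      using assms(7) unfolding assumption_II_def by blast
    have "norm (\<eta> n) = \<beta> * norm (reflection k (v n) *v grad E (x n) - spectral_map C (\<lambda>c. \<bar>?r c\<bar>) (x n - xs))"
      using \<beta>0 by (simp add: \<eta>_def e_def)
    also have "\<dots> \<le> \<beta> * ((1 + L / \<mu>) * M * (norm (x n - xs))\<^sup>2)"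
      using reflected_gradient_linearization[OF E g0 I(2,3) _ assms(3) lip spec C y v] I \<beta>0
      by (intro mult_left_mono) auto
    also have "\<dots> \<le> \<beta> * (C1 * (norm (x n - xs))\<^sup>2)"
      using C1 \<beta>0 by (intro mult_left_mono mult_right_mono) auto
    finally show ?thesis by (simp add: e_def)
  qed
  define R where "R = 4 * sqrt 2 * c * norm (e 0)"
  have Rr: "R \<le> r"
    using assms(17) c0 by (simp add: R_def e_def K pos_le_divide_eq mult_ac)
  have small: "c * (\<beta> * C1) * R * \<rho> \<le> (\<theta> - \<rho>) / 4"
  proof -
    have s32: "s powr (3/2) = s * sqrt s"
      using s2 powr_add[of s 1 "1/2"] by (simp add: powr_half_sqrt)
    \<comment> \<open>at the upper bound for \<open>r\<close> all constants cancel and exactly \<open>\<epsilon> / 4\<close> is left\<close>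
    have "R \<le> sqrt 3 * \<mu> * \<epsilon>\<^sup>2 * (s * sqrt s) / (16 * sqrt 2 * C1)"
      using Rr assms(16) unfolding s_def[symmetric] s32 by simp
    then have "c * (\<beta> * C1) * R \<le> c * (\<beta> * C1) * (sqrt 3 * \<mu> * \<epsilon>\<^sup>2 * (s * sqrt s) / (16 * sqrt 2 * C1))"
      using c0 \<beta>0 C10 by (intro mult_left_mono) auto
    also have "\<dots> = \<epsilon> / 4"
    proof -
      have ss: "sqrt s * sqrt s = s" using s2 by simp
      have "c * (\<beta> * C1) * (sqrt 3 * \<mu> * \<epsilon>\<^sup>2 * (s * sqrt s) / (16 * sqrt 2 * C1))
        = \<epsilon> * (sqrt s * sqrt s) / (4 * s)"
        using I C10 s2 eps' unfolding c_def \<beta> by (simp add: field_simps power2_eq_square del: real_sqrt_mult_self)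
      then show ?thesis using ss s2 by simp
    qed
    finally have "c * (\<beta> * C1) * R \<le> \<epsilon> / 4" .
    then have "c * (\<beta> * C1) * R * \<rho> \<le> \<epsilon> / 4 * 1"
      using \<rho>0 \<rho>1 eps' by (intro mult_mono) auto
    then show ?thesis by (simp add: \<theta>)
  qed
  have bound: "norm (e n) \<le> R * \<theta> ^ n" for n
  proof (rule perturbed_heavy_ball_convergence[OF perturbed_heavy_ball_duhamel[OF C' rec ker] \<eta>])
    show "c * (\<beta> * C1) * R * \<rho> \<le> (\<theta> - \<rho>) / 4" by (rule small)
    show "R < \<delta>" using Rr assms(16) by simp
  qed (use \<rho>0 \<rho>1 \<theta> \<theta>1 \<gamma> c0 \<beta>0 C10 eps' R_def in auto)
  have "(\<lambda>n. R * \<theta> ^ n) \<longlonglongrightarrow> R * 0"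
    using \<rho>0 eps' \<theta> \<theta>1 by (intro tendsto_intros LIMSEQ_power_zero) auto
  then have "e \<longlonglongrightarrow> 0"
    by (intro Lim_null_comparison[of e "\<lambda>n. R * \<theta> ^ n"]) (use bound in auto)
  then have "x \<longlonglongrightarrow> xs" by (simp add: e_def[abs_def] LIM_zero_iff)
  moreover have "norm (x n - xs) \<le> 2 * sqrt 2 * K * norm (x 0 - xs) * \<theta> ^ n" for n
    using bound[of n] by (simp add: R_def e_def K mult_ac)
  ultimately show ?thesis by blast
qed

end
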